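(* Let $N$ be a positive integer, $\Omega=\{-1,+1\}^N$, $\hat J\in[0,+\infty)$, let $\mu_N$ be the Gibbs measure of the one-dimensional periodic Ising model with coupling constant $\hat J$, and let $P_{\mathrm W}$ be the transition kernel of the Wolff dynamics with coupling constant $\hat J$ (whose invariant measure is $\mu_N$). Then for all functions $f:\Omega\to\mathbb R$, $$E_{\mu_N}[f^2\log f^2]-E_{\mu_N}[f^2]\log E_{\mu_N}[f^2]\le e^{2\hat J}(e^{4\hat J}+1)\Big(\frac12+\hat J e^{\frac{e^{2\hat J}-1}{2}}\Big)N\,\mathcal E^{\mathrm W}_{\mu_N}(f),$$ where $$\mathcal E^{\mathrm W}_{\mu_N}(f)=\frac12\sum_{\sigma,\eta\in\Omega}[f(\sigma)-f(\eta)]^2P_{\mathrm W}(\eta,\sigma)\mu_N(\eta).$$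
   Context: $\log$ is the natural logarithm, with $0\log0=0$. Indices in $[N]=\{1,\dots,N\}$ are cyclic ($N+1\equiv1$). The Gibbs measure is $\mu_N(\sigma)=Z_N^{-1}\exp\big(\hat J\sum_{i=1}^N\sigma_i\sigma_{i+1}\big)$ on $\Omega$, with $Z_N$ the normalizing constant; $E_{\mu_N}$ is expectation with respect to $\mu_N$. $G=([N],\mathcal G)$ is the undirected cycle with the $N$ edges $\{i,i+1\}$, $i=1,\dots,N$ (counted with multiplicity if $N=2$). Wolff dynamics: one step from $\sigma\in\Omega$ is as follows. Choose a site $i_0\in[N]$ uniformly at random and start the cluster with $i_0$. Repeatedly, for each site $i$ in the cluster and each edge joining $i$ to a neighbour $j$ with $\sigma_j=\sigma_i$ such that this edge has not been considered before, add $j$ to the cluster with probability $1-e^{-\hat J(1+\sigma_i\sigma_j)}=1-e^{-2\hat J}$, independently over edges. When no edge remains to be considered, flip all spins of the cluster (with probability 1). Equivalently: declare each edge with aligned endpoint spins open independently with probability $1-e^{-2\hat J}$ (all other edges are closed), and flip the open-connected component of $i_0$. $P_{\mathrm W}(\sigma,\eta)$ is the probability that one step from $\sigma$ produces $\eta$. *)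

theory Defs
  imports "HOL-Probability.Probability"
begin

text \<open>A configuration assigns a spin to every site in \<open>{1..N}\<close>; outside of \<open>{1..N}\<close> it takes the
  value \<^term>\<open>undefined\<close>, so that the configuration space is finite with \<open>2 ^ N\<close> elements.\<close>

type_synonym config = "nat \<Rightarrow> int"

definition configs :: "nat \<Rightarrow> config set" where
  "configs N = ({1..N} \<rightarrow>\<^sub>E {-1, 1})"

definition cyc_succ :: "nat \<Rightarrow> nat \<Rightarrow> nat" where
  "cyc_succ N i = (if i = N then 1 else i + 1)"

definition gibbs_weight :: "real \<Rightarrow> nat \<Rightarrow> config \<Rightarrow> real" where
  "gibbs_weight J N \<sigma> = exp (J * (\<Sum>i=1..N. real_of_int (\<sigma> i * \<sigma> (cyc_succ N i))))"

definition partition_fun :: "real \<Rightarrow> nat \<Rightarrow> real" where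
  "partition_fun J N = (\<Sum>\<sigma>\<in>configs N. gibbs_weight J N \<sigma>)"

definition gibbs :: "real \<Rightarrow> nat \<Rightarrow> config \<Rightarrow> real" where
  "gibbs J N \<sigma> = gibbs_weight J N \<sigma> / partition_fun J N"

definition gibbs_expectation :: "real \<Rightarrow> nat \<Rightarrow> (config \<Rightarrow> real) \<Rightarrow> real" where
  "gibbs_expectation J N f = (\<Sum>\<sigma>\<in>configs N. f \<sigma> * gibbs J N \<sigma>)"

text \<open>The edge joining \<open>i\<close> and its cyclic successor is labelled by \<open>i\<close>. Hence for \<open>N = 2\<close> the two
  parallel edges are distinct, and for \<open>N = 1\<close> the only edge is a loop. Edge configurations are
  functions \<open>w\<close> with \<open>w i\<close> meaning that edge \<open>i\<close> is open.\<close>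

definition open_edges_pmf :: "real \<Rightarrow> nat \<Rightarrow> config \<Rightarrow> (nat \<Rightarrow> bool) pmf" where
  "open_edges_pmf J N \<sigma> =
     Pi_pmf {1..N} False
       (\<lambda>i. if \<sigma> i = \<sigma> (cyc_succ N i) then bernoulli_pmf (1 - exp (- 2 * J)) else return_pmf False)"

definition open_component :: "nat \<Rightarrow> (nat \<Rightarrow> bool) \<Rightarrow> nat \<Rightarrow> nat set" where
  "open_component N w i0 =
     (let R = {(i, cyc_succ N i) | i. i \<in> {1..N} \<and> w i} in {j. (i0, j) \<in> (R \<union> R\<inverse>)\<^sup>*})"

definition flip_on :: "nat set \<Rightarrow> config \<Rightarrow> config" where
  "flip_on C \<sigma> = (\<lambda>i. if i \<in> C then - \<sigma> i else \<sigma> i)"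

definition wolff_step :: "real \<Rightarrow> nat \<Rightarrow> config \<Rightarrow> config pmf" where
  "wolff_step J N \<sigma> =
     bind_pmf (pmf_of_set {1..N}) (\<lambda>i0.
     bind_pmf (open_edges_pmf J N \<sigma>) (\<lambda>w.
     return_pmf (flip_on (open_component N w i0) \<sigma>)))"

definition wolff_kernel :: "real \<Rightarrow> nat \<Rightarrow> config \<Rightarrow> config \<Rightarrow> real" where
  "wolff_kernel J N \<sigma> \<eta> = pmf (wolff_step J N \<sigma>) \<eta>"

definition wolff_dirichlet :: "real \<Rightarrow> nat \<Rightarrow> (config \<Rightarrow> real) \<Rightarrow> real" where
  "wolff_dirichlet J N f =
     1 / 2 * (\<Sum>\<sigma>\<in>configs N. \<Sum>\<eta>\<in>configs N. (f \<sigma> - f \<eta>)\<^sup>2 * wolff_kernel J N \<eta> \<sigma> * gibbs J N \<eta>)"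

end

theory Submission
  imports Defs
begin

text \<open>
  The proof goes through the joint law of the spins and of the bonds that one Wolff step opens
  (the Edwards-Sokal coupling). Write \<open>r = 1 - exp (- 2 * J)\<close>. A pair of a spin configuration
  \<open>\<sigma>\<close> and a set \<open>W\<close> of open bonds has weight proportional to
  \<open>r ^ |W| * (1 - r) ^ (N - |W|)\<close> if \<open>\<sigma>\<close> is constant along the bonds in \<open>W\<close>, and \<open>0\<close> otherwise.
  The spin marginal is the Gibbs measure, and \<open>N\<close> times the Wolff Dirichlet form is half the mean of
  the sum over all sites of the squared change of \<open>f\<close> when the cluster of that site is
  flipped (\<open>wolff_dirichlet_fk\<close>). The entropy of \<open>f\<^sup>2\<close> splits by the chain rule into the mean
  entropy of the spins given the bonds and the entropy of \<open>G W\<close>, the conditional mean of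
  \<open>f\<^sup>2\<close> given the bonds \<open>W\<close>.

  Given \<open>W\<close>, the clusters carry independent fair signs. Gross' logarithmic Sobolev
  inequality on the discrete cube (\<open>cluster_log_sobolev\<close>) therefore bounds the first part by half of
  the sum of the squared changes of \<open>f\<close> under cluster flips, that is, by \<open>N\<close> times the Dirichlet form.

  For the second part, let \<open>p = r / (2 - r)\<close>, which is \<open>tanh J\<close>. The law of \<open>W\<close> is the
  product measure with bond density \<open>p\<close>, except that the set of all bonds has twice its weight: on a
  cycle the last bond joins two sites which are connected already. This costs a factor \<open>2\<close>
  (\<open>ent_le_of_weight_le\<close>). For the product measure the entropy is at most the sum of the
  entropies of single bonds (\<open>ent_tensorization\<close>). Opening a bond conditions the clusters
  at its two ends to agree, so \<open>G\<close> changes by the effect of flipping one of these clusters, and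
  the entropy of one bond is at most \<open>p\<close> times the mean squared change of \<open>f\<close> under that flip
  (\<open>edge_entropy_le\<close>). Restricting to closed bonds turns \<open>p\<close> into
  \<open>p / (1 - p) = (exp (2 * J) - 1) / 2\<close>.

  Altogether the inequality holds with the constant \<open>(2 * exp (2 * J) - 1) * N\<close>
  (\<open>wolff_log_sobolev\<close>). With \<open>x = exp (2 * J)\<close>, the inequality
  \<open>(x - 1)\<^sup>2 * (x + 2) \<ge> 0\<close> shows that \<open>2 * x - 1\<close> is at most \<open>x * (x\<^sup>2 + 1) / 2\<close>, which is at most
  the constant of the theorem.
\<close>

section \<open>Entropy of a function on two points\<close>

definition xlogx :: "real \<Rightarrow> real" where
  "xlogx x = x * ln x"

definition two_point_ent :: "real \<Rightarrow> real \<Rightarrow> real \<Rightarrow> real" where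
  "two_point_ent p a b = p * xlogx a + (1 - p) * xlogx b - xlogx (p * a + (1 - p) * b)"

lemma xlogx_above_tangent:
  assumes "x \<ge> 0" "t > 0"
  shows "xlogx t + (1 + ln t) * (x - t) \<le> xlogx x"
proof (cases "x = 0")
  case True
  then show ?thesis using assms by (simp add: xlogx_def algebra_simps)
next
  case False
  then have x: "x > 0" using assms by simp
  have "ln (t / x) \<le> t / x - 1" using x assms by (intro ln_le_minus_one) simp
  then have "x * (ln t - ln x) \<le> x * (t / x - 1)"
    using x assms by (intro mult_left_mono) (simp_all add: ln_div)
  then show ?thesis using x by (simp add: xlogx_def algebra_simps)
qed

lemma xlogx_below_parabola:
  assumes "x \<ge> 0" "t > 0"
  shows "xlogx x \<le> xlogx t + (1 + ln t) * (x - t) + (x - t)\<^sup>2 / t"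
proof (cases "x = 0")
  case True
  then show ?thesis using assms by (simp add: xlogx_def algebra_simps power2_eq_square)
next
  case False
  then have x: "x > 0" using assms by simp
  have "ln (x / t) \<le> x / t - 1" using x assms by (intro ln_le_minus_one) simp
  then have "x * (ln x - ln t) \<le> x * (x / t - 1)"
    using x assms by (intro mult_left_mono) (simp_all add: ln_div)
  moreover have "(x - t)\<^sup>2 / t = x * (x / t - 1) - x + t"
    using assms by (simp add: field_simps power2_eq_square)
  ultimately show ?thesis by (simp add: xlogx_def algebra_simps)
qed

text \<open>
  The parabola that touches \<open>xlogx\<close> from above at the mean has leading coefficient one over the mean,
  so averaging it leaves the variance divided by the mean.
\<close>
lemma two_point_ent_le_variance:
  assumes "0 \<le> p" "p \<le> 1" "a \<ge> 0" "b \<ge> 0" "p * a + (1 - p) * b > 0"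
  shows "two_point_ent p a b \<le> p * (1 - p) * (a - b)\<^sup>2 / (p * a + (1 - p) * b)"
proof -
  define m where "m = p * a + (1 - p) * b"
  have m: "m > 0" using assms m_def by simp
  have "p * xlogx a + (1 - p) * xlogx b
      \<le> p * (xlogx m + (1 + ln m) * (a - m) + (a - m)\<^sup>2 / m)
        + (1 - p) * (xlogx m + (1 + ln m) * (b - m) + (b - m)\<^sup>2 / m)"
    using assms m by (intro add_mono mult_left_mono xlogx_below_parabola) auto
  also have "\<dots> = xlogx m + (1 + ln m) * (p * a + (1 - p) * b - m)
                  + (p * (a - m)\<^sup>2 + (1 - p) * (b - m)\<^sup>2) / m"
    by (simp only: add_divide_distrib times_divide_eq_right) (simp add: algebra_simps)
  also have "p * (a - m)\<^sup>2 + (1 - p) * (b - m)\<^sup>2 = p * (1 - p) * (a - b)\<^sup>2"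
    unfolding m_def by algebra
  finally show ?thesis by (simp add: two_point_ent_def m_def)
qed

text \<open>
  This is the shape of the entropy of a single bond: \<open>a\<close> and \<open>c\<close> are the means of \<open>f\<^sup>2\<close> over the
  configurations in which the ends of the bond agree and disagree. The value \<open>(a + c) / 2\<close> at the
  closed bond is at least half the value at the open bond. This is why the bound is linear in
  \<open>p\<close>, whereas two unrelated values would cost a factor of order \<open>p * ln (1 / p)\<close> for small \<open>p\<close>.
\<close>
lemma two_point_ent_half_average_le:
  assumes "0 \<le> p" "p < 1" "a \<ge> 0" "c \<ge> 0" "Q \<ge> 0" "(a - c)\<^sup>2 \<le> 2 * (a + c) * Q"
  shows "two_point_ent p a ((a + c) / 2) \<le> p * Q"
proof (cases "a + c = 0")
  case True
  then have "a = 0" "c = 0" using assms by auto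
  then show ?thesis using assms by (simp add: two_point_ent_def xlogx_def)
next
  case False
  define b where "b = (a + c) / 2"
  define m where "m = p * a + (1 - p) * b"
  have b: "b > 0" using False assms by (auto simp: b_def)
  then have mb: "(1 - p) * b > 0" "(1 - p) * b \<le> m" using assms by (auto simp: m_def)
  have "a - b = (a - c) / 2" by (simp add: b_def field_simps)
  then have "(a - b)\<^sup>2 = (a - c)\<^sup>2 / 4" by (simp only: power_divide) simp
  moreover have "2 * (a + c) * Q = 4 * (b * Q)" by (simp add: b_def)
  ultimately have ab: "(a - b)\<^sup>2 \<le> b * Q" using assms(6) by linarith
  have "two_point_ent p a b \<le> p * (1 - p) * (a - b)\<^sup>2 / m"
    using assms b less_le_trans[OF mb] unfolding m_def by (intro two_point_ent_le_variance) auto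
  also have "\<dots> \<le> p * (1 - p) * (b * Q) / ((1 - p) * b)"
    using assms mb ab b by (intro frac_le mult_left_mono) auto
  also have "\<dots> = p * Q" using assms b by simp
  finally show ?thesis by (simp add: b_def)
qed

lemma two_ln_le_minus_inverse:
  fixes t :: real
  assumes "t \<ge> 1"
  shows "2 * ln t \<le> t - 1 / t"
proof -
  let ?h = "\<lambda>t::real. t - 1 / t - 2 * ln t"
  have "?h 1 \<le> ?h t"
  proof (rule DERIV_nonneg_imp_nondecreasing[OF assms])
    fix x :: real assume x: "1 \<le> x" "x \<le> t"
    have "(?h has_real_derivative (1 + 1 / x\<^sup>2 - 2 / x)) (at x)"
      using x by (auto intro!: derivative_eq_intros simp: power2_eq_square)
    moreover have "1 + 1 / x\<^sup>2 - 2 / x = (1 - 1 / x)\<^sup>2"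
      by (simp add: power2_eq_square algebra_simps)
    ultimately show "\<exists>y. (?h has_real_derivative y) (at x) \<and> y \<ge> 0"
      by (metis zero_le_power2)
  qed
  then show ?thesis by simp
qed

text \<open>
  The two sides agree at \<open>0\<close>, and the derivatives compare as \<open>artanh s \<le> s / sqrt (1 - s\<^sup>2)\<close>. This is
  the preceding lemma at \<open>t = sqrt ((1 + s) / (1 - s))\<close>.
\<close>
lemma half_binary_entropy_le:
  fixes s :: real
  assumes "0 \<le> s" "s \<le> 1"
  shows "(xlogx (1 + s) + xlogx (1 - s)) / 2 \<le> 1 - sqrt (1 - s\<^sup>2)"
proof (cases "s = 1")
  case True
  have "ln 2 \<le> (1::real)" using ln_le_minus_one[of 2] by simp
  then show ?thesis using True by (simp add: xlogx_def)
next
  case False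
  let ?h = "\<lambda>s::real. 1 - sqrt (1 - s\<^sup>2) - (xlogx (1 + s) + xlogx (1 - s)) / 2"
  have "?h 0 \<le> ?h s"
  proof (rule DERIV_nonneg_imp_nondecreasing[OF assms(1)])
    fix x :: real assume "0 \<le> x" "x \<le> s"
    then have x: "0 \<le> x" "x < 1" using assms False by auto
    then have x2: "1 - x\<^sup>2 > 0" by (simp add: power_less_one_iff abs_square_less_1)
    define t where "t = sqrt ((1 + x) / (1 - x))"
    have t1: "t \<ge> 1" using x by (simp add: t_def)
    have lnt: "2 * ln t = ln (1 + x) - ln (1 - x)"
      using x by (simp add: t_def ln_sqrt ln_div)
    have sq: "sqrt (1 - x\<^sup>2) = sqrt (1 + x) * sqrt (1 - x)"
      by (simp add: real_sqrt_mult[symmetric] algebra_simps power2_eq_square)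
    define u v where "u = sqrt (1 + x)" and "v = sqrt (1 - x)"
    have uv: "u > 0" "v > 0" "u\<^sup>2 = 1 + x" "v\<^sup>2 = 1 - x" using x by (auto simp: u_def v_def)
    have "t - 1 / t = u / v - v / u" by (simp add: t_def real_sqrt_divide u_def v_def)
    also have "\<dots> = (u\<^sup>2 - v\<^sup>2) / (u * v)" using uv by (simp add: field_simps power2_eq_square)
    also have "\<dots> = 2 * (x / sqrt (1 - x\<^sup>2))" using uv(3,4) by (simp add: sq u_def v_def)
    finally have tt: "t - 1 / t = 2 * (x / sqrt (1 - x\<^sup>2))" .
    have half: "a - b / 2 \<ge> 0" if "b \<le> 2 * a" for a b :: real using that by simp
    have "((\<lambda>s. sqrt (1 - s\<^sup>2)) has_real_derivative (- (x / sqrt (1 - x\<^sup>2)))) (at x)"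
      using x2 by (auto intro!: derivative_eq_intros simp: field_simps)
    moreover have "((\<lambda>s. xlogx (1 + s)) has_real_derivative (ln (1 + x) + 1)) (at x)"
      unfolding xlogx_def using x by (auto intro!: derivative_eq_intros)
    moreover have "((\<lambda>s. xlogx (1 - s)) has_real_derivative (- ln (1 - x) - 1)) (at x)"
      unfolding xlogx_def using x by (auto intro!: derivative_eq_intros)
    ultimately have "(?h has_real_derivative
        (0 - (- (x / sqrt (1 - x\<^sup>2))) - ((ln (1 + x) + 1) + (- ln (1 - x) - 1)) / 2)) (at x)"
      by (intro DERIV_diff DERIV_add DERIV_cdivide DERIV_const)
    then have "(?h has_real_derivative (x / sqrt (1 - x\<^sup>2) - (ln (1 + x) - ln (1 - x)) / 2)) (at x)"
      by simp
    moreover have "x / sqrt (1 - x\<^sup>2) - (ln (1 + x) - ln (1 - x)) / 2 \<ge> 0"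
      using two_ln_le_minus_inverse[OF t1] half unfolding tt lnt by blast
    ultimately show "\<exists>y. (?h has_real_derivative y) (at x) \<and> y \<ge> 0" by blast
  qed
  then show ?thesis by (simp add: xlogx_def)
qed

lemma xlogx_mult: "a \<ge> 0 \<Longrightarrow> b \<ge> 0 \<Longrightarrow> xlogx (a * b) = a * xlogx b + b * xlogx a"
  by (cases "a = 0 \<or> b = 0") (auto simp: xlogx_def ln_mult algebra_simps)

text \<open>
  Gross' inequality for a fair sign. By homogeneity the mean of the two squares may be taken to be \<open>1\<close>,
  so that they are \<open>1 + s\<close> and \<open>1 - s\<close>, and \<open>(u - v)\<^sup>2 / 2\<close> is then at least \<open>1 - sqrt (1 - s\<^sup>2)\<close>.
\<close>
lemma two_point_log_sobolev:
  "two_point_ent (1 / 2) (u\<^sup>2) (v\<^sup>2) \<le> (u - v)\<^sup>2 / 2"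
proof -
  have *: "two_point_ent (1 / 2) (u\<^sup>2) (v\<^sup>2) \<le> (u - v)\<^sup>2 / 2" if le: "v\<^sup>2 \<le> u\<^sup>2" for u v :: real
  proof (cases "u = 0")
    case True
    then show ?thesis using le by (simp add: two_point_ent_def xlogx_def)
  next
    case False
    define m where "m = (u\<^sup>2 + v\<^sup>2) / 2"
    define s where "s = (u\<^sup>2 - v\<^sup>2) / (u\<^sup>2 + v\<^sup>2)"
    have pos: "u\<^sup>2 + v\<^sup>2 > 0" using False by (simp add: sum_power2_gt_zero_iff)
    then have m: "m > 0" by (simp add: m_def)
    have s: "0 \<le> s" "s \<le> 1" using le pos by (auto simp: s_def divide_le_eq)
    have us: "u\<^sup>2 = m * (1 + s)" "v\<^sup>2 = m * (1 - s)"
    proof -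
      have "m * s = (u\<^sup>2 - v\<^sup>2) / 2" using pos by (simp add: m_def s_def del: distrib_right_numeral distrib_left_numeral)
      then show "u\<^sup>2 = m * (1 + s)" "v\<^sup>2 = m * (1 - s)"
        by (simp_all add: distrib_left right_diff_distrib) (simp_all add: m_def field_simps)
    qed
    have "1 / 2 * u\<^sup>2 + (1 - 1 / 2) * v\<^sup>2 = m" by (simp add: m_def)
    then have "two_point_ent (1 / 2) (u\<^sup>2) (v\<^sup>2)
        = (xlogx (m * (1 + s)) + xlogx (m * (1 - s))) / 2 - xlogx m"
      by (simp only: two_point_ent_def) (simp add: us add_divide_distrib)
    also have "\<dots> = m * ((xlogx (1 + s) + xlogx (1 - s)) / 2)"
    proof -
      have "xlogx (m * (1 + s)) = m * xlogx (1 + s) + (1 + s) * xlogx m"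
        "xlogx (m * (1 - s)) = m * xlogx (1 - s) + (1 - s) * xlogx m"
        using m s by (intro xlogx_mult; simp)+
      then show ?thesis by (simp only:) (simp add: field_simps)
    qed
    also have "\<dots> \<le> m * (1 - sqrt (1 - s\<^sup>2))"
      using m s by (intro mult_left_mono half_binary_entropy_le) auto
    also have "m * (1 - sqrt (1 - s\<^sup>2)) \<le> (u - v)\<^sup>2 / 2"
    proof -
      have "m * sqrt (1 - s\<^sup>2) = sqrt (m\<^sup>2 * (1 - s\<^sup>2))" using m by (simp add: real_sqrt_mult)
      also have "m\<^sup>2 * (1 - s\<^sup>2) = (m * (1 + s)) * (m * (1 - s))" by algebra
      also have "\<dots> = (u * v)\<^sup>2" by (simp add: us[symmetric] power_mult_distrib)
      finally have "m * sqrt (1 - s\<^sup>2) = \<bar>u * v\<bar>" by simp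
      then have "m * (1 - sqrt (1 - s\<^sup>2)) = m - \<bar>u * v\<bar>" by (simp add: right_diff_distrib)
      also have "\<dots> \<le> m - u * v" by simp
      also have "\<dots> = (u - v)\<^sup>2 / 2"
        by (simp add: m_def power2_diff diff_divide_distrib add_divide_distrib)
      finally show ?thesis .
    qed
    finally show ?thesis .
  qed
  show ?thesis
  proof (cases "v\<^sup>2 \<le> u\<^sup>2")
    case True
    then show ?thesis by (rule *)
  next
    case False
    then have "two_point_ent (1 / 2) (v\<^sup>2) (u\<^sup>2) \<le> (v - u)\<^sup>2 / 2" by (intro *) simp
    then show ?thesis by (simp add: two_point_ent_def power2_commute algebra_simps)
  qed
qed

text \<open>
  The variational formula: the entropy of a function is the supremum of its integrals against
  \<open>ln x\<close> over the densities \<open>x\<close>, with equality for the normalised function. This exhibits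
  the entropy as a supremum of linear functionals. Since \<open>ln 0 = 0\<close> here, the last two
  assumptions stand for the value minus infinity of the logarithm at \<open>0\<close>.
\<close>
lemma two_point_ent_dual:
  assumes "0 \<le> p" "p \<le> 1" "a \<ge> 0" "b \<ge> 0" "x \<ge> 0" "y \<ge> 0" "p * x + (1 - p) * y = 1"
    and "x = 0 \<Longrightarrow> a = 0" "y = 0 \<Longrightarrow> b = 0"
  shows "p * (a * ln x) + (1 - p) * (b * ln y) \<le> two_point_ent p a b"
proof -
  have terms: "0 \<le> p * a" "0 \<le> (1 - p) * b" using assms(1-4) by simp_all
  show ?thesis
  proof (cases "p * a + (1 - p) * b = 0")
    case True
    then have "p * a = 0" "(1 - p) * b = 0"
      using terms add_nonneg_eq_0_iff[OF terms] by blast+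
    then show ?thesis using True
      by (auto simp: two_point_ent_def xlogx_def)
  next
    case False
    define m where "m = p * a + (1 - p) * b"
    have m: "m > 0" using False terms unfolding m_def by linarith
    have key: "c * ln m + c * ln z + c - m * z \<le> xlogx c" if "c \<ge> 0" "z \<ge> 0" "z = 0 \<Longrightarrow> c = 0" for c z
    proof (cases "z = 0")
      case True
      then show ?thesis using that by (simp add: xlogx_def)
    next
      case False
      then have z: "z > 0" using that by simp
      show ?thesis using xlogx_above_tangent[of c "m * z"] that m z
        by (simp add: ln_mult xlogx_def algebra_simps)
    qed
    have "p * (a * ln m + a * ln x + a - m * x) + (1 - p) * (b * ln m + b * ln y + b - m * y)
       \<le> p * xlogx a + (1 - p) * xlogx b"
      using assms key by (intro add_mono mult_left_mono) auto
    moreover have "p * (a * ln m + a * ln x + a - m * x) + (1 - p) * (b * ln m + b * ln y + b - m * y)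
       = (p * a + (1 - p) * b) * ln m + p * (a * ln x) + (1 - p) * (b * ln y)
         + (p * a + (1 - p) * b) - m * (p * x + (1 - p) * y)" by algebra
    ultimately show ?thesis
      using assms(7) by (simp add: two_point_ent_def xlogx_def m_def[symmetric])
  qed
qed

text \<open>
  Apply the variational formula to both functions with the density that is optimal for their
  mixture.
\<close>
lemma two_point_ent_convex:
  assumes p: "0 \<le> p" "p \<le> 1" and q01: "0 \<le> q" "q \<le> 1"
    and "a \<ge> 0" "b \<ge> 0" "a' \<ge> 0" "b' \<ge> 0"
  shows "two_point_ent p (q * a + (1 - q) * a') (q * b + (1 - q) * b')
       \<le> q * two_point_ent p a b + (1 - q) * two_point_ent p a' b'"
proof (cases "q = 0 \<or> q = 1")
  case True
  then show ?thesis by auto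
next
  case False
  then have q: "0 < q" "q < 1" using q01 by auto
  (* The degenerate weights are excluded because a zero of the mixture must be a common zero of
    both functions for the variational formula to apply. *)
  define S T where "S = q * a + (1 - q) * a'" and "T = q * b + (1 - q) * b'"
  define M where "M = p * S + (1 - p) * T"
  have pos_terms: "0 \<le> q * a" "0 \<le> (1 - q) * a'" "0 \<le> q * b" "0 \<le> (1 - q) * b'"
    using q assms(5-8) by simp_all
  then have ST: "S \<ge> 0" "T \<ge> 0" by (simp_all add: S_def T_def)
  then have M_terms: "0 \<le> p * S" "0 \<le> (1 - p) * T" using p by simp_all
  have S0: "a = 0 \<and> a' = 0" if "S = 0"
  proof -
    have "q * a = 0 \<and> (1 - q) * a' = 0"
      using that pos_terms add_nonneg_eq_0_iff[of "q * a" "(1 - q) * a'"] unfolding S_def by blast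
    then show ?thesis using q by simp
  qed
  have T0: "b = 0 \<and> b' = 0" if "T = 0"
  proof -
    have "q * b = 0 \<and> (1 - q) * b' = 0"
      using that pos_terms add_nonneg_eq_0_iff[of "q * b" "(1 - q) * b'"] unfolding T_def by blast
    then show ?thesis using q by simp
  qed
  show ?thesis
  proof (cases "M = 0")
    case True
    have nonneg: "two_point_ent p c d \<ge> 0" if "c \<ge> 0" "d \<ge> 0" for c d
      using two_point_ent_dual[of p c d 1 1] that p by simp
    have "p * S = 0" "(1 - p) * T = 0" using True M_terms add_nonneg_eq_0_iff[OF M_terms]
      unfolding M_def by blast+
    then have "two_point_ent p S T = 0" by (auto simp: two_point_ent_def xlogx_def)
    moreover have "0 \<le> q * two_point_ent p a b" "0 \<le> (1 - q) * two_point_ent p a' b'"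
      using nonneg q assms(5-8) by simp_all
    ultimately show ?thesis by (simp add: S_def T_def)
  next
    case False
    have M: "M > 0" using False M_terms unfolding M_def by linarith
    define x y where "x = S / M" and "y = T / M"
    have xy: "x \<ge> 0" "y \<ge> 0" using ST M by (auto simp: x_def y_def)
    have one: "p * x + (1 - p) * y = 1"
      using M by (simp add: x_def y_def M_def add_divide_distrib[symmetric])
    have d: "p * (a * ln x) + (1 - p) * (b * ln y) \<le> two_point_ent p a b"
            "p * (a' * ln x) + (1 - p) * (b' * ln y) \<le> two_point_ent p a' b'"
      using S0 T0 M p assms(5-8) xy one by (intro two_point_ent_dual; simp add: x_def y_def)+
    have l: "S * ln x = xlogx S - S * ln M" "T * ln y = xlogx T - T * ln M"
      using ST M by (cases "S = 0"; simp add: x_def xlogx_def ln_div algebra_simps)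
        (use ST M in \<open>cases "T = 0"; simp add: y_def xlogx_def ln_div algebra_simps\<close>)
    have "two_point_ent p S T = p * (S * ln x) + (1 - p) * (T * ln y)"
      unfolding l by (simp add: two_point_ent_def xlogx_def M_def[symmetric])
        (simp add: M_def algebra_simps)
    also have "\<dots> = q * (p * (a * ln x) + (1 - p) * (b * ln y))
                  + (1 - q) * (p * (a' * ln x) + (1 - p) * (b' * ln y))"
      unfolding S_def T_def by algebra
    also have "\<dots> \<le> q * two_point_ent p a b + (1 - q) * two_point_ent p a' b'"
      using d q by (intro add_mono mult_left_mono) auto
    finally show ?thesis by (simp add: S_def T_def)
  qed
qed

section \<open>Entropy under product Bernoulli measures\<close>

definition bernoulli_weight :: "real \<Rightarrow> 'a set \<Rightarrow> 'a set \<Rightarrow> real" where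
  "bernoulli_weight p A D = p ^ card D * (1 - p) ^ card (A - D)"

lemma sum_bernoulli_weight_insert:
  assumes "finite A" "x \<notin> A"
  shows "(\<Sum>D\<in>Pow (insert x A). bernoulli_weight p (insert x A) D * h D)
       = (\<Sum>D\<in>Pow A. bernoulli_weight p A D * (p * h (insert x D) + (1 - p) * h D))"
proof -
  have inj: "inj_on (insert x) (Pow A)" using assms by (auto simp: inj_on_def)
  have "bernoulli_weight p (insert x A) (insert x D) = p * bernoulli_weight p A D" if "D \<in> Pow A" for D
  proof -
    have "insert x A - insert x D = A - D" "x \<notin> D" "finite D"
      using that assms by (auto intro: finite_subset)
    then show ?thesis by (simp add: bernoulli_weight_def)
  qed
  moreover have "bernoulli_weight p (insert x A) D = (1 - p) * bernoulli_weight p A D" if "D \<in> Pow A" for D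
  proof -
    have "insert x A - D = insert x (A - D)" using that assms by auto
    then show ?thesis using assms by (simp add: bernoulli_weight_def)
  qed
  moreover have "Pow A \<inter> insert x ` Pow A = {}" using assms by auto
  ultimately show ?thesis
    using assms inj
    by (simp add: Pow_insert sum.union_disjoint sum.reindex sum.distrib mult.assoc mult.left_commute
        distrib_left)
qed

lemma bernoulli_weight_nonneg: "0 \<le> p \<Longrightarrow> p \<le> 1 \<Longrightarrow> bernoulli_weight p A D \<ge> 0"
  by (simp add: bernoulli_weight_def)

text \<open>
  Subadditivity of entropy. Averaging over one element \<open>x\<close> splits off the mean entropy in the direction
  \<open>x\<close> and leaves the entropy of the averaged function \<open>m\<close>. By convexity, the entropies of \<open>m\<close>
  in the other directions are at most the averages of those of the original function.
\<close>
lemma ent_tensorization: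
  assumes "finite A" and p: "0 \<le> p" "p \<le> 1" and "\<And>D. D \<subseteq> A \<Longrightarrow> g D \<ge> 0"
  shows "(\<Sum>D\<in>Pow A. bernoulli_weight p A D * xlogx (g D)) - xlogx (\<Sum>D\<in>Pow A. bernoulli_weight p A D * g D)
       \<le> (\<Sum>x\<in>A. \<Sum>D\<in>Pow A. bernoulli_weight p A D * two_point_ent p (g (insert x D)) (g (D - {x})))"
  using assms(1,4)
proof (induction A arbitrary: g rule: finite_induct)
  case empty
  then show ?case by (simp add: bernoulli_weight_def)
next
  case (insert x A)
  define m where "m D = p * g (insert x D) + (1 - p) * g D" for D
  let ?E = "\<lambda>h. \<Sum>D\<in>Pow A. bernoulli_weight p A D * h D"
  let ?E' = "\<lambda>h. \<Sum>D\<in>Pow (insert x A). bernoulli_weight p (insert x A) D * h D"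
  let ?t = "\<lambda>g y D. two_point_ent p (g (insert y D)) (g (D - {y}))"
  note split = sum_bernoulli_weight_insert[OF insert.hyps(1,2)]
  have g: "g D \<ge> 0" "g (insert x D) \<ge> 0" if "D \<subseteq> A" for D using that by (auto intro!: insert.prems)
  have m: "m D \<ge> 0" if "D \<subseteq> A" for D unfolding m_def using g[OF that] p by simp
  have "?E' (\<lambda>D. xlogx (g D)) - xlogx (?E' g)
      = (?E (\<lambda>D. xlogx (m D)) - xlogx (?E m)) + ?E (\<lambda>D. two_point_ent p (g (insert x D)) (g D))"
    unfolding split by (simp add: m_def two_point_ent_def sum.distrib[symmetric] sum_subtractf[symmetric] algebra_simps)
  also have "\<dots> \<le> (\<Sum>y\<in>A. ?E (?t m y)) + ?E (\<lambda>D. two_point_ent p (g (insert x D)) (g D))"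
    using insert.IH[OF m] by simp
  also have "?E (\<lambda>D. two_point_ent p (g (insert x D)) (g D)) = ?E' (?t g x)"
  proof -
    have "D - {x} = D" if "D \<in> Pow A" for D using that insert.hyps by auto
    then show ?thesis unfolding split by (intro sum.cong) (auto simp: algebra_simps)
  qed
  also have "(\<Sum>y\<in>A. ?E (?t m y)) \<le> (\<Sum>y\<in>A. ?E' (?t g y))"
  proof (intro sum_mono)
    fix y assume y: "y \<in> A"
    then have "x \<noteq> y" using insert.hyps by auto
    show "?E (?t m y) \<le> ?E' (?t g y)"
      unfolding split
    proof (intro sum_mono mult_left_mono)
      fix D assume D: "D \<in> Pow A"
      then have sub: "insert y D \<subseteq> A" "D - {y} \<subseteq> A" using y by auto
      have "insert x D - {y} = insert x (D - {y})" "insert y (insert x D) = insert x (insert y D)"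
        using \<open>x \<noteq> y\<close> by auto
      then show "?t m y D \<le> p * ?t g y (insert x D) + (1 - p) * ?t g y D"
        unfolding m_def using p g[OF sub(1)] g[OF sub(2)]
        by (simp add: two_point_ent_convex)
    qed (use p in \<open>auto intro: bernoulli_weight_nonneg\<close>)
  qed
  finally show ?case using insert.hyps by (simp add: add.commute)
qed

lemma sum_bernoulli_weight:
  assumes "finite A"
  shows "(\<Sum>D\<in>Pow A. bernoulli_weight p A D) = 1"
  using assms
proof (induction A)
  case (insert x A)
  then show ?case using sum_bernoulli_weight_insert[OF insert.hyps(1,2), of p "\<lambda>_. 1"] by simp
qed (simp add: bernoulli_weight_def)

text \<open>
  Whether \<open>x\<close> belongs to the set is independent of the rest, so averaging a function of the rest is the
  same as conditioning on the absence of \<open>x\<close>, an event of probability \<open>1 - p\<close>.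
\<close>
lemma sum_bernoulli_weight_delete:
  assumes "finite A" "x \<in> A" "p \<noteq> 1"
  shows "(\<Sum>D\<in>Pow A. bernoulli_weight p A D * h (D - {x}))
       = (\<Sum>D\<in>Pow A. bernoulli_weight p A D * (if x \<in> D then 0 else h D)) / (1 - p)"
proof -
  define B where "B = A - {x}"
  have A: "A = insert x B" "finite B" "x \<notin> B" using assms by (auto simp: B_def)
  have *: "D - {x} = D" "x \<notin> D" if "D \<in> Pow B" for D using that A by auto
  have "(\<Sum>D\<in>Pow A. bernoulli_weight p A D * h (D - {x})) = (\<Sum>D\<in>Pow B. bernoulli_weight p B D * h D)"
    unfolding A(1) sum_bernoulli_weight_insert[OF A(2,3)] by (intro sum.cong refl) (simp add: * algebra_simps)
  moreover have "(\<Sum>D\<in>Pow A. bernoulli_weight p A D * (if x \<in> D then 0 else h D))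
      = (\<Sum>D\<in>Pow B. bernoulli_weight p B D * ((1 - p) * h D))"
    unfolding A(1) sum_bernoulli_weight_insert[OF A(2,3)] by (intro sum.cong refl) (simp add: *)
  ultimately show ?thesis using assms(3) by (simp add: sum_divide_distrib)
qed

text \<open>
  The Holley-Stroock perturbation argument. The integrand \<open>d\<close> below, the gap between \<open>xlogx\<close> and its
  tangent at \<open>t\<close>, is nonnegative, so its integrals can be compared. Integrated against \<open>\<pi>\<close>, whose mean of
  \<open>g\<close> is \<open>t\<close>, it gives the entropy; integrated against any other probability weights, it gives at least
  the entropy.
\<close>
lemma ent_le_of_weight_le:
  assumes fin: "finite A" and g: "\<And>x. x \<in> A \<Longrightarrow> g x \<ge> 0"
    and \<nu>: "\<And>x. x \<in> A \<Longrightarrow> 0 \<le> \<nu> x" "\<And>x. x \<in> A \<Longrightarrow> \<nu> x \<le> c * \<pi> x" "(\<Sum>x\<in>A. \<nu> x) = 1"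
    and \<pi>: "\<And>x. x \<in> A \<Longrightarrow> 0 \<le> \<pi> x" "(\<Sum>x\<in>A. \<pi> x) = 1"
  shows "(\<Sum>x\<in>A. \<nu> x * xlogx (g x)) - xlogx (\<Sum>x\<in>A. \<nu> x * g x)
       \<le> c * ((\<Sum>x\<in>A. \<pi> x * xlogx (g x)) - xlogx (\<Sum>x\<in>A. \<pi> x * g x))"
proof (cases "(\<Sum>x\<in>A. \<pi> x * g x) = 0")
  case True
  have "\<pi> x * g x = 0" if "x \<in> A" for x
    using True fin that g \<pi>(1) by (subst (asm) sum_nonneg_eq_0_iff) auto
  then have *: "\<pi> x = 0 \<or> g x = 0" if "x \<in> A" for x using that by auto
  then have "\<nu> x = 0 \<or> g x = 0" if "x \<in> A" for x
    using \<nu>(1,2)[OF that] that by fastforce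
  then have "\<nu> x * g x = 0" "\<nu> x * xlogx (g x) = 0" "\<pi> x * xlogx (g x) = 0" if "x \<in> A" for x
    using that * by (fastforce simp: xlogx_def)+
  then have "(\<Sum>x\<in>A. \<nu> x * g x) = 0" "(\<Sum>x\<in>A. \<nu> x * xlogx (g x)) = 0"
    "(\<Sum>x\<in>A. \<pi> x * xlogx (g x)) = 0"
    by (intro sum.neutral ballI; blast)+
  then show ?thesis using True by (simp add: xlogx_def)
next
  case False
  define t where "t = (\<Sum>x\<in>A. \<pi> x * g x)"
  define m where "m = (\<Sum>x\<in>A. \<nu> x * g x)"
  define d where "d x = xlogx (g x) - xlogx t - (1 + ln t) * (g x - t)" for x
  have "t \<ge> 0" using g \<pi>(1) by (auto simp: t_def intro!: sum_nonneg)
  then have t: "t > 0" using False by (simp add: t_def)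
  have m: "m \<ge> 0" using g \<nu>(1) by (auto simp: m_def intro!: sum_nonneg)
  have expand: "(\<Sum>x\<in>A. w x * d x)
      = (\<Sum>x\<in>A. w x * xlogx (g x)) - (xlogx t + (1 + ln t) * ((\<Sum>x\<in>A. w x * g x) - t))"
    if "(\<Sum>x\<in>A. w x) = 1" for w :: "'a \<Rightarrow> real"
  proof -
    have "(\<Sum>x\<in>A. w x * d x) = (\<Sum>x\<in>A. w x * xlogx (g x) - (1 + ln t) * (w x * g x)
            - (xlogx t - (1 + ln t) * t) * w x)"
      unfolding d_def by (intro sum.cong refl) algebra
    also have "\<dots> = (\<Sum>x\<in>A. w x * xlogx (g x)) - (1 + ln t) * (\<Sum>x\<in>A. w x * g x)
            - (xlogx t - (1 + ln t) * t) * (\<Sum>x\<in>A. w x)"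
      by (simp only: sum_subtractf sum_distrib_left[symmetric])
    finally show ?thesis using that by (simp add: algebra_simps)
  qed
  have "(\<Sum>x\<in>A. \<nu> x * xlogx (g x)) - xlogx m
      \<le> (\<Sum>x\<in>A. \<nu> x * xlogx (g x)) - (xlogx t + (1 + ln t) * (m - t))"
    using xlogx_above_tangent[OF m t] by simp
  also have "\<dots> = (\<Sum>x\<in>A. \<nu> x * d x)" using expand[OF \<nu>(3)] by (simp add: m_def)
  also have "\<dots> \<le> (\<Sum>x\<in>A. c * \<pi> x * d x)"
  proof (intro sum_mono mult_right_mono \<nu>(2))
    fix x assume "x \<in> A"
    then show "0 \<le> d x" using xlogx_above_tangent[OF g t, of x] unfolding d_def by linarith
  qed
  also have "\<dots> = c * (\<Sum>x\<in>A. \<pi> x * d x)" by (simp add: sum_distrib_left mult.assoc)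
  also have "(\<Sum>x\<in>A. \<pi> x * d x) = (\<Sum>x\<in>A. \<pi> x * xlogx (g x)) - xlogx t"
    using expand[OF \<pi>(2)] by (simp add: t_def)
  finally show ?thesis by (simp add: m_def t_def)
qed

section \<open>Spins and clusters on the cycle\<close>

definition compat :: "nat \<Rightarrow> nat set \<Rightarrow> config set" where
  "compat N W = {\<sigma> \<in> configs N. \<forall>i\<in>W. \<sigma> i = \<sigma> (cyc_succ N i)}"

text \<open>
  Sets of bonds take the place of the predicates of \<open>open_component\<close>, so that product measures on bonds
  live on a powerset.
\<close>
definition cluster :: "nat \<Rightarrow> nat set \<Rightarrow> nat \<Rightarrow> nat set" where
  "cluster N W i = open_component N (\<lambda>k. k \<in> W) i"

definition avg :: "'a set \<Rightarrow> ('a \<Rightarrow> real) \<Rightarrow> real" where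
  "avg S h = (\<Sum>x\<in>S. h x) / card S"

lemma finite_configs [simp]: "finite (configs N)"
  by (simp add: configs_def finite_PiE)

lemma finite_compat [simp]: "finite (compat N W)"
  by (simp add: compat_def)

lemma configs_spin: "\<sigma> \<in> configs N \<Longrightarrow> i \<in> {1..N} \<Longrightarrow> \<sigma> i = -1 \<or> \<sigma> i = 1"
  unfolding configs_def by (drule (1) PiE_mem) simp

lemma configs_outside: "\<sigma> \<in> configs N \<Longrightarrow> i \<notin> {1..N} \<Longrightarrow> \<sigma> i = undefined"
  unfolding configs_def by (drule (1) PiE_arb)

lemma cyc_succ_in: "i \<in> {1..N} \<Longrightarrow> cyc_succ N i \<in> {1..N}"
  by (auto simp: cyc_succ_def)

lemma inj_on_cyc_succ: "inj_on (cyc_succ N) {1..N}"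
  by (auto simp: inj_on_def cyc_succ_def split: if_splits)

lemma cyc_succ_image: "cyc_succ N ` {1..N} = {1..N}"
  using cyc_succ_in by (intro endo_inj_surj inj_on_cyc_succ) auto

lemma flip_on_flip_on [simp]: "flip_on C (flip_on C \<sigma>) = \<sigma>"
  by (auto simp: flip_on_def)

lemma flip_on_configs:
  assumes "C \<subseteq> {1..N}" "\<sigma> \<in> configs N"
  shows "flip_on C \<sigma> \<in> configs N"
  unfolding configs_def
proof (rule PiE_I)
  fix i assume "i \<in> {1..N}"
  then show "flip_on C \<sigma> i \<in> {- 1, 1}"
    using configs_spin[OF assms(2)] by (auto simp: flip_on_def)
next
  fix i assume "i \<notin> {1..N}"
  then show "flip_on C \<sigma> i = undefined"
    using configs_outside[OF assms(2), of i] assms(1) by (auto simp: flip_on_def)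
qed

definition links :: "nat \<Rightarrow> nat set \<Rightarrow> nat rel" where
  "links N W = (let R = {(i, cyc_succ N i) | i. i \<in> {1..N} \<and> i \<in> W} in R \<union> R\<inverse>)"

lemma cluster_iff: "j \<in> cluster N W i \<longleftrightarrow> (i, j) \<in> (links N W)\<^sup>*"
  by (simp add: cluster_def open_component_def links_def Let_def)

lemma cluster_self: "i \<in> cluster N W i"
  by (simp add: cluster_iff)

lemma cluster_eqI:
  assumes "j \<in> cluster N W i"
  shows "cluster N W j = cluster N W i"
proof -
  have sym: "sym ((links N W)\<^sup>*)" by (intro sym_rtrancl) (auto simp: sym_def links_def Let_def)
  have ij: "(i, j) \<in> (links N W)\<^sup>*" using assms by (simp only: cluster_iff)
  show ?thesis using ij symD[OF sym ij] by (auto simp: cluster_iff intro: rtrancl_trans)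
qed

text \<open>
  Invariants along open bonds are invariants of clusters. That clusters stay inside the
  cycle and do not reach across two closed bonds follows by suitable choices of \<open>s\<close>.
\<close>
lemma cluster_const:
  assumes "\<And>k. k \<in> {1..N} \<Longrightarrow> k \<in> W \<Longrightarrow> s k = s (cyc_succ N k)" "j \<in> cluster N W i"
  shows "s j = s i"
proof -
  have "(i, j) \<in> (links N W)\<^sup>*" using assms(2) by (simp only: cluster_iff)
  then show ?thesis
    by (induction rule: rtrancl_induct) (use assms(1) in \<open>auto simp: links_def Let_def\<close>)
qed

lemma cluster_edge:
  assumes "k \<in> {1..N}" "k \<in> W"
  shows "k \<in> cluster N W i \<longleftrightarrow> cyc_succ N k \<in> cluster N W i"
proof -
  have "(k, cyc_succ N k) \<in> links N W" "(cyc_succ N k, k) \<in> links N W"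
    using assms by (auto simp: links_def Let_def)
  then show ?thesis by (auto simp: cluster_iff intro: rtrancl_into_rtrancl)
qed

lemma cluster_subset: "i \<in> {1..N} \<Longrightarrow> cluster N W i \<subseteq> {1..N}"
proof
  fix j assume "i \<in> {1..N}" "j \<in> cluster N W i"
  then show "j \<in> {1..N}"
    using cluster_const[of N W "\<lambda>j. j \<in> {1..N}" j i] cyc_succ_in by blast
qed

lemma flip_cluster_compat:
  assumes "W \<subseteq> {1..N}" "i \<in> {1..N}" "\<sigma> \<in> compat N W"
  shows "flip_on (cluster N W i) \<sigma> \<in> compat N W"
proof -
  have "flip_on (cluster N W i) \<sigma> k = flip_on (cluster N W i) \<sigma> (cyc_succ N k)" if "k \<in> W" for k
    using cluster_edge[of k N W i] that assms by (auto simp: flip_on_def compat_def)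
  then show ?thesis
    using assms flip_on_configs[OF cluster_subset] by (auto simp: compat_def)
qed

text \<open>
  A cycle falls apart when two edges are removed: the arc strictly between two closed bonds is an
  invariant that changes only across these two bonds.
\<close>
lemma cluster_not_across:
  assumes W: "W \<subseteq> {1..N}" and e: "e \<in> {1..N}" "e \<notin> W" and "insert e W \<noteq> {1..N}"
  shows "e \<notin> cluster N W (cyc_succ N e)"
proof
  assume across: "e \<in> cluster N W (cyc_succ N e)"
  obtain e' where e': "e' \<in> {1..N}" "e' \<notin> W" "e' \<noteq> e" using assms by blast
  define s where "s i \<longleftrightarrow> min e e' < i \<and> i \<le> max e e'" for i
  have jump: "s k = s (cyc_succ N k) \<longleftrightarrow> k \<noteq> e \<and> k \<noteq> e'" if "k \<in> {1..N}" for k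
    using that e e' by (auto simp: s_def cyc_succ_def min_def max_def)
  have "s e = s (cyc_succ N e)"
    using across by (rule cluster_const[rotated]) (use jump e e' in auto)
  then show False using jump e by auto
qed

lemma compat_antimono: "V \<subseteq> W \<Longrightarrow> compat N W \<subseteq> compat N V"
  by (auto simp: compat_def)

text \<open>
  When \<open>e\<close> and some further bond are closed, the flip of the cluster at one end of \<open>e\<close> is an involution that
  exchanges agreement and disagreement of the spins at the ends of \<open>e\<close>.
\<close>
lemma sum_compat_split:
  assumes W: "W \<subseteq> {1..N}" and e: "e \<in> {1..N}" "e \<notin> W" and not_full: "insert e W \<noteq> {1..N}"
  shows "(\<Sum>\<sigma>\<in>compat N W. h \<sigma>)
       = (\<Sum>\<sigma>\<in>compat N (insert e W). h \<sigma> + h (flip_on (cluster N W (cyc_succ N e)) \<sigma>) :: real)"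
proof -
  let ?F = "flip_on (cluster N W (cyc_succ N e))"
  let ?T = "compat N W - compat N (insert e W)"
  have stays: "?F \<sigma> e = \<sigma> e" for \<sigma>
    using cluster_not_across[OF assms] by (simp add: flip_on_def)
  have flips: "?F \<sigma> (cyc_succ N e) = - \<sigma> (cyc_succ N e)" for \<sigma>
    by (simp add: flip_on_def cluster_self)
  have in_W: "?F \<sigma> \<in> compat N W" if "\<sigma> \<in> compat N W" for \<sigma>
    using that W e cyc_succ_in by (intro flip_cluster_compat) auto
  have toggle: "?F \<sigma> \<in> compat N (insert e W) \<longleftrightarrow> \<sigma> \<notin> compat N (insert e W)"
    if \<sigma>: "\<sigma> \<in> compat N W" for \<sigma>
  proof -
    have "\<sigma> e = -1 \<or> \<sigma> e = 1" "\<sigma> (cyc_succ N e) = -1 \<or> \<sigma> (cyc_succ N e) = 1"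
      using \<sigma> configs_spin[of \<sigma> N] e cyc_succ_in[OF e(1)] unfolding compat_def by blast+
    then show ?thesis using in_W[OF \<sigma>] \<sigma> stays flips by (auto simp: compat_def)
  qed
  have sub: "compat N (insert e W) \<subseteq> compat N W" by (intro compat_antimono) auto
  have "(\<Sum>\<sigma>\<in>?T. h \<sigma>) = (\<Sum>\<sigma>\<in>compat N (insert e W). h (?F \<sigma>))"
    by (rule sum.reindex_bij_witness[of _ ?F ?F]) (use toggle in_W sub in auto)
  then show ?thesis
    using sum.subset_diff[OF sub, of h] by (simp add: sum.distrib)
qed

text \<open>
  The product of all bond signs \<open>\<sigma> i * \<sigma> (cyc_succ N i)\<close> around the cycle contains every spin twice, so
  it equals \<open>1\<close> and the last sign is determined by the others.
\<close>
lemma compat_all_but_one: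
  assumes e: "e \<in> {1..N}"
  shows "compat N ({1..N} - {e}) = compat N {1..N}"
proof
  show "compat N ({1..N} - {e}) \<subseteq> compat N {1..N}"
  proof
    fix \<sigma> assume \<sigma>: "\<sigma> \<in> compat N ({1..N} - {e})"
    then have conf: "\<sigma> \<in> configs N" by (simp add: compat_def)
    have sq: "\<sigma> i * \<sigma> i = 1" if "i \<in> {1..N}" for i using configs_spin[OF conf that] by auto
    let ?c = "\<lambda>i. \<sigma> i * \<sigma> (cyc_succ N i)"
    have "(\<Prod>i\<in>{1..N}. ?c i) = (\<Prod>i\<in>{1..N}. \<sigma> i) * (\<Prod>i\<in>cyc_succ N ` {1..N}. \<sigma> i)"
      by (simp only: prod.distrib prod.reindex[OF inj_on_cyc_succ] o_def)
    also have "\<dots> = (\<Prod>i\<in>{1..N}. \<sigma> i * \<sigma> i)" by (simp only: cyc_succ_image prod.distrib)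
    also have "\<dots> = 1" using sq by (intro prod.neutral) auto
    also have "(\<Prod>i\<in>{1..N}. ?c i) = ?c e * (\<Prod>i\<in>{1..N} - {e}. ?c i)"
      using e by (intro prod.remove) auto
    also have "(\<Prod>i\<in>{1..N} - {e}. ?c i) = 1"
    proof (intro prod.neutral ballI)
      fix i assume i: "i \<in> {1..N} - {e}"
      then have "\<sigma> (cyc_succ N i) = \<sigma> i" using \<sigma> by (simp add: compat_def)
      then show "?c i = 1" using sq[of i] i by simp
    qed
    finally have "?c e = 1" by simp
    then have "\<sigma> e = \<sigma> (cyc_succ N e)"
      using configs_spin[OF conf e] configs_spin[OF conf cyc_succ_in[OF e]] by auto
    then show "\<sigma> \<in> compat N {1..N}" using \<sigma> by (auto simp: compat_def)
  qed
qed (intro compat_antimono, blast)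

lemma compat_full:
  assumes "N \<ge> 1"
  shows "compat N {1..N} = (\<lambda>c. \<lambda>i\<in>{1..N}. c) ` {-1, 1}"
proof
  show "compat N {1..N} \<subseteq> (\<lambda>c. \<lambda>i\<in>{1..N}. c) ` {-1, 1}"
  proof
    fix \<sigma> assume \<sigma>: "\<sigma> \<in> compat N {1..N}"
    have const: "\<sigma> k = \<sigma> 1" if "1 \<le> k" "k \<le> N" for k
      using that
    proof (induction k rule: dec_induct)
      case (step k)
      then have "\<sigma> k = \<sigma> (cyc_succ N k)" using \<sigma> by (simp add: compat_def)
      then show ?case using step by (simp add: cyc_succ_def)
    qed simp
    have conf: "\<sigma> \<in> configs N" using \<sigma> by (simp add: compat_def)
    have "\<sigma> = (\<lambda>i\<in>{1..N}. \<sigma> 1)"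
    proof
      fix i show "\<sigma> i = (\<lambda>i\<in>{1..N}. \<sigma> 1) i"
        using const[of i] configs_outside[OF conf, of i] by (cases "i \<in> {1..N}") auto
    qed
    moreover have "\<sigma> 1 \<in> {-1, 1}" using configs_spin[OF conf, of 1] assms by auto
    ultimately show "\<sigma> \<in> (\<lambda>c. \<lambda>i\<in>{1..N}. c) ` {-1, 1}" by blast
  qed
next
  show "(\<lambda>c. \<lambda>i\<in>{1..N}. c) ` {-1, 1} \<subseteq> compat N {1..N}"
    using cyc_succ_in by (auto simp: compat_def configs_def)
qed

text \<open>
  Closing a bond doubles the number of compatible configurations, except for the first one: it cuts
  the cycle open without disconnecting it. Hence the exceptional value at the full set of bonds.
\<close>
lemma card_compat:
  assumes "N \<ge> 1" "W \<subseteq> {1..N}"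
  shows "card (compat N W) = (if W = {1..N} then 2 else 2 ^ card ({1..N} - W))"
  using assms(2)
proof (induction "card ({1..N} - W)" arbitrary: W)
  case 0
  then have "W = {1..N}" by auto
  moreover have "card ((\<lambda>c::int. \<lambda>i\<in>{1..N}. c) ` {-1, 1}) = 2"
  proof -
    have "(\<lambda>i\<in>{1..N}. -1::int) \<noteq> (\<lambda>i\<in>{1..N}. 1)"
      using assms(1) by (auto simp: fun_eq_iff intro!: exI[of _ 1])
    then show ?thesis by simp
  qed
  ultimately show ?case using compat_full[OF assms(1)] by simp
next
  case (Suc n)
  then obtain e where e: "e \<in> {1..N}" "e \<notin> W"
    by (metis DiffE card.empty equals0I nat.distinct(1))
  have diff: "{1..N} - W = insert e ({1..N} - insert e W)" using e by auto
  have n: "n = card ({1..N} - insert e W)" using Suc.hyps(2) by (subst (asm) diff) simp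
  have ne: "W \<noteq> {1..N}" using e by auto
  show ?case
  proof (cases "insert e W = {1..N}")
    case True
    then have "W = {1..N} - {e}" using e by auto
    then have "compat N W = compat N (insert e W)" using compat_all_but_one[OF e(1)] True by simp
    then show ?thesis using Suc.hyps(1)[OF n] Suc.hyps(2) True ne n e Suc.prems by simp
  next
    case False
    have "real (card (compat N W)) = real (2 * card (compat N (insert e W)))"
      using sum_compat_split[OF Suc.prems e False, of "\<lambda>_. 1"] by simp
    then have "card (compat N W) = 2 * card (compat N (insert e W))" by linarith
    also have "card (compat N (insert e W)) = 2 ^ n"
      using Suc.hyps(1)[OF n] n False e Suc.prems by simp
    finally have "card (compat N W) = 2 ^ Suc n" by simp
    then show ?thesis using ne by (simp only: Suc.hyps(2) if_False)
  qed
qed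

lemma compat_nonempty: "N \<ge> 1 \<Longrightarrow> W \<subseteq> {1..N} \<Longrightarrow> compat N W \<noteq> {}"
  using card_compat[of N W] by (auto split: if_splits)

section \<open>Entropy of one bond and of the spins given the bonds\<close>

text \<open>
  If \<open>e\<close> is closed, the mean of \<open>f\<^sup>2\<close> is half the sum of its means over the configurations in which the
  ends of \<open>e\<close> agree and over their images under the cluster flip. By Cauchy-Schwarz, the difference of
  these two means is controlled by the mean squared change of \<open>f\<close> under the flip. If \<open>e\<close> is the
  only closed bond, opening it changes nothing.
\<close>
lemma edge_entropy_le:
  assumes N: "N \<ge> 1" and W: "W \<subseteq> {1..N}" and e: "e \<in> {1..N}" "e \<notin> W"
    and p: "0 \<le> p" "p < 1"
  shows "two_point_ent p (avg (compat N (insert e W)) (\<lambda>\<sigma>. (f \<sigma>)\<^sup>2)) (avg (compat N W) (\<lambda>\<sigma>. (f \<sigma>)\<^sup>2))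
      \<le> p * avg (compat N W) (\<lambda>\<sigma>. (f \<sigma> - f (flip_on (cluster N W (cyc_succ N e)) \<sigma>))\<^sup>2)"
    (is "_ \<le> p * ?Q")
proof (cases "insert e W = {1..N}")
  case True
  have Q: "?Q \<ge> 0" by (simp add: avg_def sum_nonneg)
  have "W = {1..N} - {e}" using e True by auto
  then have "compat N W = compat N (insert e W)" using compat_all_but_one[OF e(1)] True by simp
  then show ?thesis using Q p by (simp add: two_point_ent_def algebra_simps)
next
  case False
  let ?S = "compat N (insert e W)"
  define n where "n = real (card ?S)"
  define fC where "fC \<sigma> = f (flip_on (cluster N W (cyc_succ N e)) \<sigma>)" for \<sigma>
  define A C where "A = (\<Sum>\<sigma>\<in>?S. (f \<sigma>)\<^sup>2)" and "C = (\<Sum>\<sigma>\<in>?S. (fC \<sigma>)\<^sup>2)"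
  define Q where "Q = (\<Sum>\<sigma>\<in>?S. (f \<sigma> - fC \<sigma>)\<^sup>2)"
  note split = sum_compat_split[OF W e False]
  have n: "n > 0" using card_compat[OF N, of "insert e W"] W e by (simp add: n_def)
  have card: "real (card (compat N W)) = 2 * n"
    using split[of "\<lambda>_. 1"] by (simp add: n_def)
  have "(A - C)\<^sup>2 = (\<Sum>\<sigma>\<in>?S. (f \<sigma> - fC \<sigma>) * (f \<sigma> + fC \<sigma>))\<^sup>2"
    by (simp add: A_def C_def sum_subtractf[symmetric] algebra_simps power2_eq_square)
  also have "\<dots> \<le> Q * (\<Sum>\<sigma>\<in>?S. (f \<sigma> + fC \<sigma>)\<^sup>2)"
    unfolding Q_def by (rule Cauchy_Schwarz_ineq_sum)
  also have "\<dots> \<le> Q * (\<Sum>\<sigma>\<in>?S. 2 * ((f \<sigma>)\<^sup>2 + (fC \<sigma>)\<^sup>2))"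
  proof (intro mult_left_mono sum_mono)
    fix \<sigma> show "(f \<sigma> + fC \<sigma>)\<^sup>2 \<le> 2 * ((f \<sigma>)\<^sup>2 + (fC \<sigma>)\<^sup>2)"
      using zero_le_power2[of "f \<sigma> - fC \<sigma>"] by (simp add: power2_eq_square algebra_simps)
  qed (simp add: Q_def sum_nonneg)
  also have "\<dots> = 2 * (A + C) * Q"
    by (simp only: A_def C_def sum.distrib[symmetric] sum_distrib_left[symmetric] mult.commute[of Q])
  finally have AC: "(A - C)\<^sup>2 \<le> 2 * (A + C) * Q" .
  have "(A / n - C / n)\<^sup>2 = (A - C)\<^sup>2 / n\<^sup>2" by (simp add: diff_divide_distrib[symmetric] power_divide)
  also have "\<dots> \<le> 2 * (A + C) * Q / n\<^sup>2" using AC by (intro divide_right_mono) auto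
  also have "\<dots> = 2 * (A / n + C / n) * (Q / n)"
    by (simp add: add_divide_distrib[symmetric] power2_eq_square)
  finally have ineq: "(A / n - C / n)\<^sup>2 \<le> 2 * (A / n + C / n) * (Q / n)" .
  have "two_point_ent p (A / n) ((A / n + C / n) / 2) \<le> p * (Q / n)"
    using p n ineq by (intro two_point_ent_half_average_le) (auto simp: A_def C_def Q_def sum_nonneg)
  moreover have "avg ?S (\<lambda>\<sigma>. (f \<sigma>)\<^sup>2) = A / n" by (simp add: avg_def A_def n_def)
  moreover have "avg (compat N W) (\<lambda>\<sigma>. (f \<sigma>)\<^sup>2) = (A / n + C / n) / 2"
    unfolding avg_def card by (subst split) (simp add: A_def C_def fC_def sum.distrib add_divide_distrib)
  moreover have "?Q = Q / n"
  proof -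
    have "(f \<sigma> - fC \<sigma>)\<^sup>2 + (fC \<sigma> - f \<sigma>)\<^sup>2 = 2 * (f \<sigma> - fC \<sigma>)\<^sup>2" for \<sigma>
      by (simp add: power2_commute)
    then show ?thesis
      unfolding avg_def card by (subst split) (simp add: Q_def fC_def sum_distrib_left[symmetric])
  qed
  ultimately show ?thesis by (simp only:)
qed

text \<open>
  A configuration that is constant on clusters is determined by the set \<open>D\<close> of clusters on which the
  spin is \<open>-1\<close>, and every set of clusters occurs. The uniform measure on such configurations is
  thus the fair product measure on sets of clusters, for which the inequality follows from
  tensorization and the case of a single sign.
\<close>
lemma cluster_log_sobolev:
  assumes W: "W \<subseteq> {1..N}"
  shows "avg (compat N W) (\<lambda>\<sigma>. xlogx ((f \<sigma>)\<^sup>2)) - xlogx (avg (compat N W) (\<lambda>\<sigma>. (f \<sigma>)\<^sup>2))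
       \<le> 1 / 2 * avg (compat N W) (\<lambda>\<sigma>. \<Sum>C\<in>cluster N W ` {1..N}. (f \<sigma> - f (flip_on C \<sigma>))\<^sup>2)"
proof -
  define K where "K = cluster N W ` {1..N}"
  define \<Phi> where "\<Phi> D = (\<lambda>i\<in>{1..N}. if i \<in> \<Union>D then -1 else (1::int))" for D
  have finK: "finite K" by (simp add: K_def)
  have K_eq: "C = C'" if "C \<in> K" "C' \<in> K" "i \<in> C" "i \<in> C'" for C C' i
    using that cluster_eqI unfolding K_def by blast
  have K_sub: "C \<subseteq> {1..N}" if "C \<in> K" for C
    using that cluster_subset unfolding K_def by blast
  have K_ne: "C \<noteq> {}" if "C \<in> K" for C
    using that cluster_self unfolding K_def by blast
  have K_edge: "k \<in> C \<longleftrightarrow> cyc_succ N k \<in> C" if "C \<in> K" "k \<in> W" for C k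
    using that cluster_edge W unfolding K_def by blast
  have bij: "bij_betw \<Phi> (Pow K) (compat N W)"
  proof (rule bij_betw_byWitness[where f' = "\<lambda>\<sigma>. {C \<in> K. \<forall>i\<in>C. \<sigma> i = -1}"])
    show "\<forall>D\<in>Pow K. {C \<in> K. \<forall>i\<in>C. \<Phi> D i = - 1} = D"
    proof
      fix D assume D: "D \<in> Pow K"
      show "{C \<in> K. \<forall>i\<in>C. \<Phi> D i = - 1} = D"
      proof (intro equalityI subsetI)
        fix C assume C: "C \<in> {C \<in> K. \<forall>i\<in>C. \<Phi> D i = - 1}"
        then obtain i where i: "i \<in> C" using K_ne by blast
        then have "\<Phi> D i = -1" "i \<in> {1..N}" using C K_sub[of C] by blast+
        then have "i \<in> \<Union>D" by (auto simp: \<Phi>_def split: if_splits)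
        then obtain C' where "C' \<in> D" "i \<in> C'" by blast
        then show "C \<in> D" using K_eq[of C C' i] C D i by auto
      next
        fix C assume "C \<in> D"
        moreover from this D have "C \<subseteq> {1..N}" by (intro K_sub) blast
        ultimately show "C \<in> {C \<in> K. \<forall>i\<in>C. \<Phi> D i = - 1}"
          using D by (auto simp: \<Phi>_def)
      qed
    qed
    show "\<forall>\<sigma>\<in>compat N W. \<Phi> {C \<in> K. \<forall>i\<in>C. \<sigma> i = -1} = \<sigma>"
    proof
      fix \<sigma> assume \<sigma>: "\<sigma> \<in> compat N W"
      then have conf: "\<sigma> \<in> configs N" by (simp add: compat_def)
      have const: "\<sigma> j = \<sigma> i" if "j \<in> cluster N W i" for i j
        using \<sigma> unfolding compat_def by (intro cluster_const[OF _ that]) blast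
      show "\<Phi> {C \<in> K. \<forall>i\<in>C. \<sigma> i = -1} = \<sigma>"
      proof
        fix i
        show "\<Phi> {C \<in> K. \<forall>i\<in>C. \<sigma> i = -1} i = \<sigma> i"
        proof (cases "i \<in> {1..N}")
          case True
          have "cluster N W i \<in> {C \<in> K. \<forall>i\<in>C. \<sigma> i = -1}" if "\<sigma> i = -1"
            using const[of _ i] that True unfolding K_def by fastforce
          then have "i \<in> \<Union>{C \<in> K. \<forall>i\<in>C. \<sigma> i = -1} \<longleftrightarrow> \<sigma> i = -1"
            using cluster_self[of i N W] by blast
          then show ?thesis using configs_spin[OF conf True] True
            by (simp only: \<Phi>_def restrict_apply if_True) auto
        next
          case False
          then show ?thesis using configs_outside[OF conf False] by (simp only: \<Phi>_def restrict_apply if_False)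
        qed
      qed
    qed
    show "\<Phi> ` Pow K \<subseteq> compat N W"
    proof
      fix \<sigma> assume "\<sigma> \<in> \<Phi> ` Pow K"
      then obtain D where D: "D \<subseteq> K" "\<sigma> = \<Phi> D" by auto
      have "\<Phi> D k = \<Phi> D (cyc_succ N k)" if "k \<in> W" for k
      proof -
        have "k \<in> {1..N}" "cyc_succ N k \<in> {1..N}" using that W cyc_succ_in[of k N] by blast+
        moreover have "k \<in> \<Union>D \<longleftrightarrow> cyc_succ N k \<in> \<Union>D" using K_edge that D(1) by blast
        ultimately show ?thesis by (simp only: \<Phi>_def restrict_apply)
      qed
      moreover have "\<Phi> D \<in> configs N" by (auto simp: \<Phi>_def configs_def)
      ultimately show "\<sigma> \<in> compat N W" unfolding D(2) compat_def by blast
    qed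
    show "(\<lambda>\<sigma>. {C \<in> K. \<forall>i\<in>C. \<sigma> i = - 1}) ` compat N W \<subseteq> Pow K" by auto
  qed
  have card: "real (card (compat N W)) = 2 ^ card K"
    using bij_betw_same_card[OF bij] finK by (simp add: card_Pow)
  have bernoulli_weight: "bernoulli_weight (1 / 2) K D = 1 / 2 ^ card K" if "D \<in> Pow K" for D
    using that finK by (simp add: bernoulli_weight_def power_add[symmetric] card_Diff_subset finite_subset
        card_mono power_one_over)
  have avg_eq: "avg (compat N W) h = (\<Sum>D\<in>Pow K. bernoulli_weight (1 / 2) K D * h (\<Phi> D))" for h
    unfolding avg_def card sum.reindex_bij_betw[OF bij, symmetric, of h]
    by (simp add: sum_divide_distrib bernoulli_weight)
  have flip_in: "flip_on C (\<Phi> D) = \<Phi> (D - {C})" if "C \<in> D" "D \<subseteq> K" for C D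
  proof
    fix i
    have C: "C \<subseteq> {1..N}" using that by (intro K_sub) blast
    show "flip_on C (\<Phi> D) i = \<Phi> (D - {C}) i"
    proof (cases "i \<in> C")
      case True
      then have "i \<in> \<Union>D" "i \<notin> \<Union>(D - {C})" "i \<in> {1..N}"
        using that C K_eq[of C _ i] by blast+
      then show ?thesis using True by (simp only: \<Phi>_def flip_on_def restrict_apply if_True if_False)
    next
      case False
      then have "i \<in> \<Union>D \<longleftrightarrow> i \<in> \<Union>(D - {C})" by blast
      then show ?thesis using False by (simp only: \<Phi>_def flip_on_def restrict_apply if_False)
    qed
  qed
  have flip_out: "flip_on C (\<Phi> D) = \<Phi> (insert C D)" if "C \<notin> D" "C \<in> K" "D \<subseteq> K" for C D
  proof -
    have "flip_on C (\<Phi> (insert C D)) = \<Phi> D" using flip_in[of C "insert C D"] that by simp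
    then show ?thesis by (metis flip_on_flip_on)
  qed
  have "avg (compat N W) (\<lambda>\<sigma>. xlogx ((f \<sigma>)\<^sup>2)) - xlogx (avg (compat N W) (\<lambda>\<sigma>. (f \<sigma>)\<^sup>2))
      \<le> (\<Sum>C\<in>K. \<Sum>D\<in>Pow K. bernoulli_weight (1 / 2) K D
            * two_point_ent (1 / 2) ((f (\<Phi> (insert C D)))\<^sup>2) ((f (\<Phi> (D - {C})))\<^sup>2))"
    unfolding avg_eq using finK by (intro ent_tensorization) auto
  also have "\<dots> \<le> (\<Sum>C\<in>K. \<Sum>D\<in>Pow K. bernoulli_weight (1 / 2) K D * (1 / 2 * (f (\<Phi> D) - f (flip_on C (\<Phi> D)))\<^sup>2))"
  proof (intro sum_mono mult_left_mono)
    fix C D assume C: "C \<in> K" and D: "D \<in> Pow K"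
    have "two_point_ent (1 / 2) ((f (\<Phi> (insert C D)))\<^sup>2) ((f (\<Phi> (D - {C})))\<^sup>2)
        \<le> (f (\<Phi> (insert C D)) - f (\<Phi> (D - {C})))\<^sup>2 / 2"
      by (rule two_point_log_sobolev)
    also have "\<dots> = 1 / 2 * (f (\<Phi> D) - f (flip_on C (\<Phi> D)))\<^sup>2"
    proof (cases "C \<in> D")
      case True
      then show ?thesis using D flip_in by (simp add: insert_absorb)
    next
      case False
      then show ?thesis using C D flip_out by (simp add: power2_commute)
    qed
    finally show "two_point_ent (1 / 2) ((f (\<Phi> (insert C D)))\<^sup>2) ((f (\<Phi> (D - {C})))\<^sup>2)
        \<le> 1 / 2 * (f (\<Phi> D) - f (flip_on C (\<Phi> D)))\<^sup>2" .
  qed (simp add: bernoulli_weight_nonneg)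
  also have "\<dots> = (\<Sum>D\<in>Pow K. bernoulli_weight (1 / 2) K D * (1 / 2 * (\<Sum>C\<in>K. (f (\<Phi> D) - f (flip_on C (\<Phi> D)))\<^sup>2)))"
    by (subst sum.swap) (simp add: sum_distrib_left)
  also have "\<dots> = 1 / 2 * avg (compat N W) (\<lambda>\<sigma>. \<Sum>C\<in>K. (f \<sigma> - f (flip_on C \<sigma>))\<^sup>2)"
    unfolding avg_eq by (simp add: sum_distrib_left mult.left_commute)
  finally show ?thesis by (simp only: K_def)
qed

section \<open>The Edwards-Sokal coupling of the Gibbs measure and the Wolff dynamics\<close>

text \<open>
  The weight of \<open>W\<close> together with any one compatible spin configuration in the Edwards-Sokal coupling.
\<close>
definition fk_weight :: "real \<Rightarrow> nat \<Rightarrow> nat set \<Rightarrow> real" where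
  "fk_weight J N W = exp (J * N) / partition_fun J N
     * ((1 - exp (- 2 * J)) ^ card W * exp (- 2 * J) ^ card ({1..N} - W))"

lemma gibbs_weight_eq_prod:
  assumes "\<sigma> \<in> configs N"
  shows "gibbs_weight J N \<sigma>
       = exp (J * N) * (\<Prod>i=1..N. if \<sigma> i = \<sigma> (cyc_succ N i) then 1 else exp (- 2 * J))"
proof -
  have "exp (J * real_of_int (\<sigma> i * \<sigma> (cyc_succ N i)))
      = exp J * (if \<sigma> i = \<sigma> (cyc_succ N i) then 1 else exp (- 2 * J))" if "i \<in> {1..N}" for i
    using configs_spin[OF assms that] configs_spin[OF assms cyc_succ_in[OF that]]
    by (auto simp: exp_add[symmetric])
  then have "gibbs_weight J N \<sigma>
      = (\<Prod>i=1..N. exp J * (if \<sigma> i = \<sigma> (cyc_succ N i) then 1 else exp (- 2 * J)))"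
    unfolding gibbs_weight_def sum_distrib_left exp_sum[OF finite_atLeastAtMost]
    by (intro prod.cong) auto
  also have "\<dots> = exp J ^ N * (\<Prod>i=1..N. if \<sigma> i = \<sigma> (cyc_succ N i) then 1 else exp (- 2 * J))"
    by (simp add: prod.distrib)
  finally show ?thesis by (simp add: exp_of_nat_mult[symmetric] mult.commute)
qed

lemma set_open_edges: "set_pmf (open_edges_pmf J N \<sigma>) \<subseteq> (\<lambda>W i. i \<in> W) ` Pow {1..N}"
proof
  fix w assume "w \<in> set_pmf (open_edges_pmf J N \<sigma>)"
  then have "w = (\<lambda>i. i \<in> {i \<in> {1..N}. w i})"
    using set_Pi_pmf_subset[of "{1..N}" False] unfolding open_edges_pmf_def by fastforce
  then show "w \<in> (\<lambda>W i. i \<in> W) ` Pow {1..N}" by blast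
qed

text \<open>
  An antialigned pair of neighbours costs the Gibbs weight the factor \<open>exp (- 2 * J)\<close>, which is also the
  probability that an aligned bond stays closed. Hence a closed bond has the same
  weight in both cases, and the joint weight depends on the spins only through compatibility.
\<close>
lemma gibbs_open_edges:
  assumes \<sigma>: "\<sigma> \<in> configs N" and J: "J \<ge> 0" and W: "W \<subseteq> {1..N}"
  shows "gibbs J N \<sigma> * pmf (open_edges_pmf J N \<sigma>) (\<lambda>i. i \<in> W)
       = (if \<sigma> \<in> compat N W then fk_weight J N W else 0)"
proof -
  define q where "q = exp (- 2 * J)"
  have q: "0 < q" "q \<le> 1" using J by (auto simp: q_def)
  let ?al = "\<lambda>i. \<sigma> i = \<sigma> (cyc_succ N i)"
  have "gibbs J N \<sigma> * pmf (open_edges_pmf J N \<sigma>) (\<lambda>i. i \<in> W)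
      = exp (J * N) / partition_fun J N * (\<Prod>i=1..N. (if ?al i then 1 else q)
          * pmf (if ?al i then bernoulli_pmf (1 - q) else return_pmf False) (i \<in> W))"
    unfolding gibbs_def gibbs_weight_eq_prod[OF \<sigma>] open_edges_pmf_def prod.distrib q_def
    using W by (subst pmf_Pi') auto
  also have "(\<Prod>i=1..N. (if ?al i then 1 else q)
          * pmf (if ?al i then bernoulli_pmf (1 - q) else return_pmf False) (i \<in> W))
      = (\<Prod>i=1..N. if i \<in> W then (if ?al i then 1 - q else 0) else q)"
    using q by (intro prod.cong) auto
  also have "\<dots> = (\<Prod>i\<in>W. if ?al i then 1 - q else 0) * q ^ card ({1..N} - W)"
    using W by (simp add: prod.If_cases Int_absorb1 Diff_eq)
  also have "(\<Prod>i\<in>W. if ?al i then 1 - q else 0) = (if \<sigma> \<in> compat N W then (1 - q) ^ card W else 0)"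
  proof (cases "\<sigma> \<in> compat N W")
    case True
    then show ?thesis by (simp add: compat_def)
  next
    case False
    then obtain i where "i \<in> W" "\<not> ?al i" using \<sigma> by (auto simp: compat_def)
    then have "(\<Prod>i\<in>W. if ?al i then 1 - q else 0) = 0"
      using finite_subset[OF W] by (intro prod_zero) auto
    then show ?thesis using False by simp
  qed
  finally show ?thesis by (simp add: fk_weight_def q_def)
qed

lemma gibbs_expectation_open_edges:
  assumes \<sigma>: "\<sigma> \<in> configs N" and J: "J \<ge> 0"
  shows "gibbs J N \<sigma> * measure_pmf.expectation (open_edges_pmf J N \<sigma>) h
       = (\<Sum>W\<in>Pow {1..N}. if \<sigma> \<in> compat N W then fk_weight J N W * h (\<lambda>i. i \<in> W) else (0::real))"
proof -
  have inj: "inj_on (\<lambda>W i. i \<in> W) (Pow {1..N::nat})" by (auto simp: inj_on_def fun_eq_iff)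
  have "measure_pmf.expectation (open_edges_pmf J N \<sigma>) h
      = (\<Sum>w\<in>(\<lambda>W i. i \<in> W) ` Pow {1..N}. h w * pmf (open_edges_pmf J N \<sigma>) w)"
    by (intro integral_measure_pmf_real subsetD[OF set_open_edges]) simp_all
  also have "\<dots> = (\<Sum>W\<in>Pow {1..N}. h (\<lambda>i. i \<in> W) * pmf (open_edges_pmf J N \<sigma>) (\<lambda>i. i \<in> W))"
    by (subst sum.reindex[OF inj]) (simp add: o_def)
  finally have "gibbs J N \<sigma> * measure_pmf.expectation (open_edges_pmf J N \<sigma>) h
     = (\<Sum>W\<in>Pow {1..N}. h (\<lambda>i. i \<in> W) * (gibbs J N \<sigma> * pmf (open_edges_pmf J N \<sigma>) (\<lambda>i. i \<in> W)))"
    by (simp add: sum_distrib_left mult_ac)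
  also have "\<dots> = (\<Sum>W\<in>Pow {1..N}. if \<sigma> \<in> compat N W then fk_weight J N W * h (\<lambda>i. i \<in> W) else 0)"
    by (intro sum.cong refl) (simp add: gibbs_open_edges[OF \<sigma> J])
  finally show ?thesis .
qed

lemma sum_compat_swap:
  "(\<Sum>\<sigma>\<in>configs N. \<Sum>W\<in>Pow {1..N}. if \<sigma> \<in> compat N W then h W \<sigma> else 0)
     = (\<Sum>W\<in>Pow {1..N}. \<Sum>\<sigma>\<in>compat N W. h W \<sigma> :: real)"
proof -
  have "(\<Sum>\<sigma>\<in>configs N. if \<sigma> \<in> compat N W then h W \<sigma> else 0) = (\<Sum>\<sigma>\<in>compat N W. h W \<sigma>)" for W
    by (subst sum.inter_restrict[symmetric]) (auto intro: sum.cong simp: compat_def)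
  then show ?thesis by (subst sum.swap) simp
qed

lemma gibbs_expectation_fk:
  assumes "J \<ge> 0"
  shows "gibbs_expectation J N h = (\<Sum>W\<in>Pow {1..N}. fk_weight J N W * (\<Sum>\<sigma>\<in>compat N W. h \<sigma>))"
proof -
  have "gibbs_expectation J N h
      = (\<Sum>\<sigma>\<in>configs N. \<Sum>W\<in>Pow {1..N}. if \<sigma> \<in> compat N W then fk_weight J N W * h \<sigma> else 0)"
    unfolding gibbs_expectation_def
    using gibbs_expectation_open_edges[OF _ assms, of _ N "\<lambda>_. h _"]
    by (intro sum.cong refl) (simp add: mult.commute)
  then show ?thesis by (simp only: sum_compat_swap sum_distrib_left)
qed

text \<open>
  The factor \<open>1 / N\<close> of the uniform starting site is what the factor \<open>N\<close> in front of the Dirichlet form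
  compensates.
\<close>
lemma expectation_wolff_step:
  assumes "N \<ge> 1"
  shows "measure_pmf.expectation (wolff_step J N \<sigma>) h
       = (\<Sum>i\<in>{1..N}. measure_pmf.expectation (open_edges_pmf J N \<sigma>)
            (\<lambda>w. h (flip_on (open_component N w i) \<sigma>))) / (real N :: real)"
proof -
  have fin: "finite (set_pmf (open_edges_pmf J N \<sigma>))"
    by (rule finite_subset[OF set_open_edges]) simp
  have "measure_pmf.expectation (wolff_step J N \<sigma>) h
      = (\<Sum>i\<in>{1..N}. measure_pmf.expectation (open_edges_pmf J N \<sigma> \<bind>
            (\<lambda>w. return_pmf (flip_on (open_component N w i) \<sigma>))) h /\<^sub>R real (card {1..N}))"
    unfolding wolff_step_def using assms fin by (intro pmf_expectation_bind_pmf_of_set) auto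
  then show ?thesis
    by (simp add: map_pmf_def[symmetric] divide_inverse sum_distrib_left mult.commute)
qed

lemma set_wolff_step:
  assumes "N \<ge> 1" "\<sigma> \<in> configs N"
  shows "set_pmf (wolff_step J N \<sigma>) \<subseteq> configs N"
proof
  fix \<eta> assume "\<eta> \<in> set_pmf (wolff_step J N \<sigma>)"
  then obtain i w where i: "i \<in> {1..N}" and w: "w \<in> set_pmf (open_edges_pmf J N \<sigma>)"
    and \<eta>: "\<eta> = flip_on (open_component N w i) \<sigma>"
    using assms(1) by (auto simp: wolff_step_def)
  obtain W where "w = (\<lambda>i. i \<in> W)" using w set_open_edges by blast
  then show "\<eta> \<in> configs N"
    using flip_on_configs[OF cluster_subset[OF i] assms(2)] \<eta> by (simp add: cluster_def)
qed

lemma wolff_dirichlet_fk: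
  assumes N: "N \<ge> 1" and J: "J \<ge> 0"
  shows "real N * wolff_dirichlet J N f
       = 1 / 2 * (\<Sum>W\<in>Pow {1..N}. fk_weight J N W *
           (\<Sum>\<sigma>\<in>compat N W. \<Sum>i\<in>{1..N}. (f \<sigma> - f (flip_on (cluster N W i) \<sigma>))\<^sup>2))"
proof -
  have inner: "real N * (\<Sum>\<sigma>\<in>configs N. (f \<sigma> - f \<eta>)\<^sup>2 * wolff_kernel J N \<eta> \<sigma> * gibbs J N \<eta>)
      = (\<Sum>W\<in>Pow {1..N}. if \<eta> \<in> compat N W
          then fk_weight J N W * (\<Sum>i\<in>{1..N}. (f \<eta> - f (flip_on (cluster N W i) \<eta>))\<^sup>2) else 0)"
    if \<eta>: "\<eta> \<in> configs N" for \<eta>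
  proof -
    have "(\<Sum>\<sigma>\<in>configs N. (f \<sigma> - f \<eta>)\<^sup>2 * wolff_kernel J N \<eta> \<sigma> * gibbs J N \<eta>)
        = gibbs J N \<eta> * measure_pmf.expectation (wolff_step J N \<eta>) (\<lambda>\<sigma>. (f \<sigma> - f \<eta>)\<^sup>2)"
      unfolding wolff_kernel_def
      by (subst integral_measure_pmf_real[OF finite_configs])
        (use set_wolff_step[OF N \<eta>] in \<open>auto simp: sum_distrib_left mult_ac\<close>)
    also have "real N * \<dots> = (\<Sum>i\<in>{1..N}. gibbs J N \<eta> * measure_pmf.expectation (open_edges_pmf J N \<eta>)
            (\<lambda>w. (f (flip_on (open_component N w i) \<eta>) - f \<eta>)\<^sup>2))"
      unfolding expectation_wolff_step[OF N] sum_distrib_left[symmetric] using N by simp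
    also have "\<dots> = (\<Sum>i\<in>{1..N}. \<Sum>W\<in>Pow {1..N}. if \<eta> \<in> compat N W
          then fk_weight J N W * (f \<eta> - f (flip_on (cluster N W i) \<eta>))\<^sup>2 else 0)"
      unfolding gibbs_expectation_open_edges[OF \<eta> J]
      by (intro sum.cong refl) (simp add: cluster_def power2_commute)
    also have "\<dots> = (\<Sum>W\<in>Pow {1..N}. if \<eta> \<in> compat N W
          then fk_weight J N W * (\<Sum>i\<in>{1..N}. (f \<eta> - f (flip_on (cluster N W i) \<eta>))\<^sup>2) else 0)"
      by (subst sum.swap) (auto intro!: sum.cong simp: sum_distrib_left)
    finally show ?thesis .
  qed
  have "real N * wolff_dirichlet J N f
      = 1 / 2 * (\<Sum>\<eta>\<in>configs N. real N *
          (\<Sum>\<sigma>\<in>configs N. (f \<sigma> - f \<eta>)\<^sup>2 * wolff_kernel J N \<eta> \<sigma> * gibbs J N \<eta>))"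
    unfolding wolff_dirichlet_def by (subst sum.swap) (simp add: sum_distrib_left)
  also have "\<dots> = 1 / 2 * (\<Sum>\<eta>\<in>configs N. \<Sum>W\<in>Pow {1..N}. if \<eta> \<in> compat N W
          then fk_weight J N W * (\<Sum>i\<in>{1..N}. (f \<eta> - f (flip_on (cluster N W i) \<eta>))\<^sup>2) else 0)"
    using inner by simp
  also have "\<dots> = 1 / 2 * (\<Sum>W\<in>Pow {1..N}. \<Sum>\<eta>\<in>compat N W.
          fk_weight J N W * (\<Sum>i\<in>{1..N}. (f \<eta> - f (flip_on (cluster N W i) \<eta>))\<^sup>2))"
    by (simp only: sum_compat_swap)
  finally show ?thesis by (simp only: sum_distrib_left)
qed

lemma partition_fun_pos: "partition_fun J N > 0"
proof -
  have "(\<lambda>i\<in>{1..N}. 1) \<in> configs N" by (auto simp: configs_def)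
  then have "configs N \<noteq> {}" by blast
  then show ?thesis unfolding partition_fun_def by (intro sum_pos) (auto simp: gibbs_weight_def)
qed

section \<open>The logarithmic Sobolev inequality for the Wolff dynamics\<close>

text \<open>
  Here \<open>\<nu>\<close> is the law of the open bonds, \<open>G W\<close> the conditional mean of \<open>f\<^sup>2\<close> and \<open>D\<close> is \<open>2 * N\<close> times the
  Dirichlet form. The facts \<open>spins\<close> and \<open>bonds\<close> bound the two terms of the chain rule.
\<close>
theorem wolff_log_sobolev:
  fixes f :: "config \<Rightarrow> real"
  assumes N: "N \<ge> 1" and J: "J \<ge> 0"
  shows "gibbs_expectation J N (\<lambda>\<sigma>. xlogx ((f \<sigma>)\<^sup>2)) - xlogx (gibbs_expectation J N (\<lambda>\<sigma>. (f \<sigma>)\<^sup>2))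
       \<le> (2 * exp (2 * J) - 1) * (real N * wolff_dirichlet J N f)"
proof -
  let ?E = "{1..N}"
  define r where "r = 1 - exp (- 2 * J)"
  (* Each closed bond contributes the factor 1 - r to the weight and, by doubling the number of
    compatible configurations, a factor 2; an open bond contributes r. Normalising r against
    2 * (1 - r) gives the density p. *)
  define p where "p = r / (2 - r)"
  have r: "0 \<le> r" "r < 1" using J by (auto simp: r_def)
  have p: "0 \<le> p" "p < 1" and p': "1 - p = 2 * (1 - r) / (2 - r)"
    using r by (auto simp: p_def field_simps)
  define \<kappa> where "\<kappa> = exp (J * N) / partition_fun J N * (2 - r) ^ N"
  have \<kappa>: "\<kappa> > 0" using r partition_fun_pos[of J N] by (simp add: \<kappa>_def)
  define \<nu> where "\<nu> W = fk_weight J N W * card (compat N W)" for W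
  define S where "S W = compat N W" for W
  define fC where "fC C \<sigma> = (f \<sigma> - f (flip_on C \<sigma>))\<^sup>2" for C \<sigma>
  define G where "G W = avg (S W) (\<lambda>\<sigma>. (f \<sigma>)\<^sup>2)" for W
  define D where "D = (\<Sum>W\<in>Pow ?E. \<nu> W * avg (S W) (\<lambda>\<sigma>. \<Sum>i\<in>?E. fC (cluster N W i) \<sigma>))"
  have \<nu>_bern: "\<nu> W = \<kappa> * bernoulli_weight p ?E W * (if W = ?E then 2 else 1)" if W: "W \<in> Pow ?E" for W
  proof -
    define a b where "a = card W" and "b = card (?E - W)"
    have ab: "N = a + b" using W card_mono[of ?E W] finite_subset[of W ?E]
      by (simp add: a_def b_def card_Diff_subset)
    have "(2 - r) ^ N * (p ^ a * (1 - p) ^ b) = ((2 - r) * p) ^ a * ((2 - r) * (1 - p)) ^ b"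
      by (simp add: ab power_add power_mult_distrib)
    also have "(2 - r) * p = r" using r by (simp add: p_def)
    also have "(2 - r) * (1 - p) = 2 * (1 - r)" using r by (simp add: p')
    finally have "(2 - r) ^ N * (p ^ a * (1 - p) ^ b) = r ^ a * (1 - r) ^ b * 2 ^ b"
      by (simp only: power_mult_distrib mult_ac)
    moreover have "real (card (compat N W)) = (if W = ?E then 2 else 1) * 2 ^ b"
      using card_compat[OF N, of W] W by (auto simp: b_def)
    ultimately show ?thesis
      by (simp add: \<nu>_def \<kappa>_def bernoulli_weight_def fk_weight_def a_def b_def r_def)
  qed
  have bern0: "bernoulli_weight p ?E W \<ge> 0" for W using p by (simp add: bernoulli_weight_nonneg)
  have \<nu>0: "\<nu> W \<ge> 0" if "W \<in> Pow ?E" for W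
    unfolding \<nu>_bern[OF that] using \<kappa> bern0 by simp
  have \<nu>_avg: "\<nu> W * avg (S W) h = fk_weight J N W * (\<Sum>\<sigma>\<in>compat N W. h \<sigma>)" if "W \<in> Pow ?E" for W h
  proof -
    have "compat N W \<noteq> {}" using compat_nonempty[OF N] that by blast
    then show ?thesis by (simp add: \<nu>_def avg_def S_def)
  qed
  have gibbs_eq: "gibbs_expectation J N h = (\<Sum>W\<in>Pow ?E. \<nu> W * avg (S W) h)" for h
    unfolding gibbs_expectation_fk[OF J] by (intro sum.cong refl) (simp only: \<nu>_avg)
  have dirichlet: "real N * wolff_dirichlet J N f = D / 2"
  proof -
    have "D = (\<Sum>W\<in>Pow ?E. fk_weight J N W * (\<Sum>\<sigma>\<in>compat N W. \<Sum>i\<in>?E. fC (cluster N W i) \<sigma>))"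
      unfolding D_def by (intro sum.cong refl \<nu>_avg)
    then show ?thesis unfolding wolff_dirichlet_fk[OF N J] fC_def by simp
  qed
  have \<nu>1: "(\<Sum>W\<in>Pow ?E. \<nu> W) = 1"
  proof -
    have "gibbs_expectation J N (\<lambda>_. 1) = 1"
      using partition_fun_pos[of J N]
      by (simp add: gibbs_expectation_def gibbs_def sum_divide_distrib[symmetric] partition_fun_def)
    moreover have "avg (S W) (\<lambda>_. 1) = 1" if "W \<in> Pow ?E" for W
      using compat_nonempty[OF N, of W] that by (simp add: avg_def S_def)
    ultimately show ?thesis using gibbs_eq[of "\<lambda>_. 1"] by simp
  qed
  have avg_mono: "avg T h \<le> avg T h'" if "\<And>\<sigma>. h \<sigma> \<le> h' \<sigma>" for T :: "config set" and h h'
    unfolding avg_def by (intro divide_right_mono sum_mono that) auto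

  have spins: "(\<Sum>W\<in>Pow ?E. \<nu> W * (avg (S W) (\<lambda>\<sigma>. xlogx ((f \<sigma>)\<^sup>2)) - xlogx (G W))) \<le> D / 2"
  proof -
    have "avg (S W) (\<lambda>\<sigma>. xlogx ((f \<sigma>)\<^sup>2)) - xlogx (G W)
        \<le> 1 / 2 * avg (S W) (\<lambda>\<sigma>. \<Sum>i\<in>?E. fC (cluster N W i) \<sigma>)" if "W \<in> Pow ?E" for W
    proof -
      have "avg (S W) (\<lambda>\<sigma>. xlogx ((f \<sigma>)\<^sup>2)) - xlogx (G W)
          \<le> 1 / 2 * avg (S W) (\<lambda>\<sigma>. \<Sum>C\<in>cluster N W ` ?E. fC C \<sigma>)"
        using cluster_log_sobolev[of W N f] that by (simp add: S_def G_def fC_def)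
      (* Each cluster contains at least one site, so it is counted by the sum over sites. *)
      also have "\<dots> \<le> 1 / 2 * avg (S W) (\<lambda>\<sigma>. \<Sum>i\<in>?E. fC (cluster N W i) \<sigma>)"
        using sum_image_le[of ?E "\<lambda>C. fC C _" "cluster N W"]
        by (intro mult_left_mono avg_mono) (auto simp: fC_def o_def)
      finally show ?thesis .
    qed
    then have "(\<Sum>W\<in>Pow ?E. \<nu> W * (avg (S W) (\<lambda>\<sigma>. xlogx ((f \<sigma>)\<^sup>2)) - xlogx (G W)))
        \<le> (\<Sum>W\<in>Pow ?E. \<nu> W * (1 / 2 * avg (S W) (\<lambda>\<sigma>. \<Sum>i\<in>?E. fC (cluster N W i) \<sigma>)))"
      using \<nu>0 by (intro sum_mono mult_left_mono) auto
    then show ?thesis by (simp add: D_def sum_distrib_left sum_divide_distrib)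
  qed

  have bonds: "(\<Sum>W\<in>Pow ?E. \<nu> W * xlogx (G W)) - xlogx (\<Sum>W\<in>Pow ?E. \<nu> W * G W)
      \<le> (exp (2 * J) - 1) * D"
  proof -
    define Q where "Q e W = avg (S W) (\<lambda>\<sigma>. fC (cluster N W (cyc_succ N e)) \<sigma>)" for e W
    have Q0: "Q e W \<ge> 0" for e W by (simp add: Q_def avg_def fC_def sum_nonneg)
    have G0: "G W \<ge> 0" for W by (simp add: G_def avg_def sum_nonneg)
    have "(\<Sum>W\<in>Pow ?E. \<nu> W * xlogx (G W)) - xlogx (\<Sum>W\<in>Pow ?E. \<nu> W * G W)
        \<le> 2 * \<kappa> * ((\<Sum>W\<in>Pow ?E. bernoulli_weight p ?E W * xlogx (G W)) - xlogx (\<Sum>W\<in>Pow ?E. bernoulli_weight p ?E W * G W))"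
    proof (rule ent_le_of_weight_le)
      fix W assume "W \<in> Pow ?E"
      then show "\<nu> W \<le> 2 * \<kappa> * bernoulli_weight p ?E W" using \<kappa> bern0 by (simp add: \<nu>_bern)
    qed (use \<nu>0 \<nu>1 G0 bern0 sum_bernoulli_weight[of ?E p] in auto)
    also have "\<dots> \<le> 2 * \<kappa> * (\<Sum>e\<in>?E. \<Sum>W\<in>Pow ?E. bernoulli_weight p ?E W
            * two_point_ent p (G (insert e W)) (G (W - {e})))"
      using \<kappa> p G0 by (intro mult_left_mono ent_tensorization) auto
    (* The bond e does not belong to W - {e}, where the cluster at its right end is taken. *)
    also have "\<dots> \<le> 2 * \<kappa> * (\<Sum>e\<in>?E. \<Sum>W\<in>Pow ?E. bernoulli_weight p ?E W * (p * Q e (W - {e})))"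
    proof (intro mult_left_mono sum_mono)
      fix e W assume e: "e \<in> ?E" and W: "W \<in> Pow ?E"
      have "two_point_ent p (G (insert e (W - {e}))) (G (W - {e})) \<le> p * Q e (W - {e})"
        unfolding G_def Q_def S_def fC_def using W e p N by (intro edge_entropy_le) auto
      then show "two_point_ent p (G (insert e W)) (G (W - {e})) \<le> p * Q e (W - {e})" by simp
    qed (use \<kappa> bern0 in auto)
    also have "\<dots> = 2 * \<kappa> * (\<Sum>e\<in>?E. p / (1 - p) * (\<Sum>W\<in>Pow ?E. bernoulli_weight p ?E W * (if e \<in> W then 0 else Q e W)))"
    proof -
      have "(\<Sum>W\<in>Pow ?E. bernoulli_weight p ?E W * (p * Q e (W - {e})))
          = p / (1 - p) * (\<Sum>W\<in>Pow ?E. bernoulli_weight p ?E W * (if e \<in> W then 0 else Q e W))" if "e \<in> ?E" for e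
        using sum_bernoulli_weight_delete[of ?E e p "Q e"] that p
        by (simp add: mult.left_commute[of _ p] sum_distrib_left[symmetric])
      then show ?thesis by simp
    qed
    also have "\<dots> = 2 * p / (1 - p) * (\<Sum>W\<in>Pow ?E. \<kappa> * bernoulli_weight p ?E W * (\<Sum>e\<in>?E. if e \<in> W then 0 else Q e W))"
      by (simp add: sum_distrib_left mult_ac) (rule sum.swap)
    also have "\<dots> \<le> 2 * p / (1 - p) * (\<Sum>W\<in>Pow ?E. \<nu> W * (\<Sum>e\<in>?E. Q e W))"
    proof (intro mult_left_mono sum_mono mult_mono)
      fix W assume W: "W \<in> Pow ?E"
      show "\<kappa> * bernoulli_weight p ?E W \<le> \<nu> W" using \<kappa> bern0 by (simp add: \<nu>_bern[OF W])
      show "0 \<le> \<nu> W" by (rule \<nu>0[OF W])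
    qed (use Q0 p in \<open>auto intro: sum_nonneg\<close>)
    (* Every site is the right end of exactly one bond. *)
    also have "(\<Sum>W\<in>Pow ?E. \<nu> W * (\<Sum>e\<in>?E. Q e W)) = D"
    proof -
      have "(\<Sum>e\<in>?E. Q e W) = avg (S W) (\<lambda>\<sigma>. \<Sum>i\<in>?E. fC (cluster N W i) \<sigma>)" for W
      proof -
        have "(\<Sum>e\<in>?E. fC (cluster N W (cyc_succ N e)) \<sigma>) = (\<Sum>i\<in>?E. fC (cluster N W i) \<sigma>)" for \<sigma>
          using sum.reindex[OF inj_on_cyc_succ, of "\<lambda>i. fC (cluster N W i) \<sigma>" N]
          by (simp only: cyc_succ_image o_def)
        then show ?thesis
          unfolding Q_def avg_def sum_divide_distrib[symmetric] by (subst sum.swap) (simp only:)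
      qed
      then show ?thesis by (simp add: D_def)
    qed
    also have "2 * p / (1 - p) = exp (2 * J) - 1"
    proof -
      have "2 * (a / b) / (2 * c / b) = a / c" if "b \<noteq> 0" for a b c :: real
        using that by simp
      from this[of "2 - r" r "1 - r"] have "2 * p / (1 - p) = r / (1 - r)"
        unfolding p' using r by (simp only: p_def)
      also have "\<dots> = exp (2 * J) - 1" by (simp add: r_def exp_minus field_simps)
      finally show ?thesis .
    qed
    finally show ?thesis .
  qed

  have "gibbs_expectation J N (\<lambda>\<sigma>. xlogx ((f \<sigma>)\<^sup>2)) - xlogx (gibbs_expectation J N (\<lambda>\<sigma>. (f \<sigma>)\<^sup>2))
      = (\<Sum>W\<in>Pow ?E. \<nu> W * (avg (S W) (\<lambda>\<sigma>. xlogx ((f \<sigma>)\<^sup>2)) - xlogx (G W)))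
        + ((\<Sum>W\<in>Pow ?E. \<nu> W * xlogx (G W)) - xlogx (\<Sum>W\<in>Pow ?E. \<nu> W * G W))"
    by (simp add: gibbs_eq G_def right_diff_distrib sum_subtractf)
  also have "\<dots> \<le> D / 2 + (exp (2 * J) - 1) * D" by (rule add_mono[OF spins bonds])
  finally show ?thesis unfolding dirichlet by (simp add: algebra_simps)
qed

theorem theorem3p7:
  fixes N :: nat and J :: real and f :: "config \<Rightarrow> real"
  assumes "N \<ge> 1" and "J \<ge> 0"
  shows "gibbs_expectation J N (\<lambda>\<sigma>. (f \<sigma>)\<^sup>2 * ln ((f \<sigma>)\<^sup>2))
           - gibbs_expectation J N (\<lambda>\<sigma>. (f \<sigma>)\<^sup>2) * ln (gibbs_expectation J N (\<lambda>\<sigma>. (f \<sigma>)\<^sup>2))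
         \<le> exp (2 * J) * (exp (4 * J) + 1) * (1 / 2 + J * exp ((exp (2 * J) - 1) / 2))
             * real N * wolff_dirichlet J N f"
proof -
  define x where "x = exp (2 * J)"
  have x: "x \<ge> 1" using assms by (simp add: x_def)
  have x4: "exp (4 * J) = x\<^sup>2" by (simp add: x_def power2_eq_square exp_add[symmetric])
  have "0 \<le> (x - 1)\<^sup>2 * (x + 2)" using x by simp
  also have "\<dots> = x * (x\<^sup>2 + 1) - 2 * (2 * x - 1)" by algebra
  finally have "2 * x - 1 \<le> x * (x\<^sup>2 + 1) * (1 / 2)" by simp
  also have "\<dots> \<le> x * (x\<^sup>2 + 1) * (1 / 2 + J * exp ((x - 1) / 2))"
    using x assms by (intro mult_left_mono) auto
  finally have const: "2 * x - 1 \<le> x * (x\<^sup>2 + 1) * (1 / 2 + J * exp ((x - 1) / 2))" .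
  have "0 \<le> wolff_dirichlet J N f"
    using partition_fun_pos[of J N]
    by (auto simp: wolff_dirichlet_def wolff_kernel_def gibbs_def gibbs_weight_def intro!: sum_nonneg)
  then have "(2 * x - 1) * (real N * wolff_dirichlet J N f)
      \<le> x * (x\<^sup>2 + 1) * (1 / 2 + J * exp ((x - 1) / 2)) * (real N * wolff_dirichlet J N f)"
    using const by (intro mult_right_mono) auto
  then show ?thesis
    using wolff_log_sobolev[OF assms, of f] by (simp add: xlogx_def x4 x_def[symmetric] mult.assoc)
qed

end
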